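(* Consider the stochastic block model $G_N$ with $M$ blocks of equal size $N/M$, intra-block edge probabilities $p_1(N)\ge\dots\ge p_M(N)$ and inter-block edge probability $q(N)$, with $\gamma_m,\gamma_{\min},\gamma_{\max},p_{\min},p_{\max}$ as defined in the context. Assume that for every $m=1,\dots,M$ $$\frac{M\log^4 N}{Np_m+N(M-1)q}\cdot\frac{\gamma_{\max}^2}{\gamma_{\min}^2}\xrightarrow[N\to\infty]{}0,$$ that $$((M-1)q)^2\gg\Big(\frac{M\log N}{N}\Big)^{1/4}p_{\min}^{5/4}\,p_{\max}^{1/2},$$ and that the limit $\kappa=\lim_{N\to\infty}\frac{(M-1)q}{p_{\min}}\in[0,\infty]$ exists. Then, for $v\in V_N$, $$H^v=N(1+o(1))$$ asymptotically almost surely.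
   Context: Model: $M$ is the (fixed) number of blocks and $N\to\infty$ runs through multiples of $M$ with $M<N$. The vertex set $V=V_N=\{1,\dots,N\}$ is partitioned into blocks $V^{(1)},\dots,V^{(M)}$ of size $N/M$ each. $p_1\ge\dots\ge p_M$ and $q$ are numbers in $[0,1]$ depending on $N$ (the argument $N$ is often suppressed). In the random graph $G_N=(V_N,E_N)$ the edge indicators $\varepsilon_{v,w}\in\{0,1\}$ of the unordered pairs $\{v,w\}$ (loops $v=w$ allowed) are independent; $\varepsilon_{v,w}=1$ with probability $p_m$ if $v,w$ are both in $V^{(m)}$, and with probability $q$ if they are in different blocks. Put $a_{v,w}=\varepsilon_{v,w}$ and $d_v=\sum_{w\in V}a_{v,w}$ (a loop counts once). $E$ is the edge set (including loops) and $L$ the set of loops, so $\sum_v d_v=2|E|-|L|$. Parameters: $\gamma_m=\frac NM p_m+(M-1)\frac NM q$ (expected degree of a vertex in block $m$), $\gamma_{\min}=\min_m\gamma_m$, $\gamma_{\max}=\max_m\gamma_m$, $p_{\min}=\min_m p_m=p_M$, $p_{\max}=\max_m p_m=p_1$. Random walk: for a realization of $G_N$, the simple random walk in discrete time jumps from $v$ to $w$ with probability $1/d_v$ if $\{v,w\}\in E$, and $0$ otherwise. Its invariant distribution is $\pi_v=d_v/(2|E|-|L|)$. $H_{vw}$ is the expected time for the walk started in $v$ to reach $w$ (so $H_{ww}=0$), a random variable through the graph. Define $H^v=\sum_{w\in V}\pi_wH_{vw}$. The realization is tacitly assumed connected (under the hypotheses this has probability tending to $1$). Conventions: $a_N\ll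 b_N$ (equivalently $b_N\gg a_N$) means $a_N/b_N\to0$. An event holds asymptotically almost surely (a.a.s.) if its probability tends to $1$ as $N\to\infty$; "$X_N=x_N(1+o(1))$ a.a.s." means that there is a deterministic sequence $\delta_N\to0$ with $|X_N/x_N-1|\le\delta_N$ a.a.s. *)

theory Defs
  imports "HOL-Probability.Probability" "HOL-Probability.Product_PMF"
begin

section \<open>The simple random walk on a finite graph\<close>

text \<open>
  A realization of a graph on \<open>{1..N}\<close> is given by its edge indicators, a function
  \<open>\<epsilon> :: nat set \<Rightarrow> bool\<close> on the unordered pairs; \<open>{v, v} = {v}\<close> is the loop at \<open>v\<close>.
\<close>

definition verts :: "nat \<Rightarrow> nat set" where
  "verts N = {1..N}"

definition pairs :: "nat \<Rightarrow> nat set set" where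
  "pairs N = {{v, w} | v w. v \<in> verts N \<and> w \<in> verts N}"

definition edge_set :: "nat \<Rightarrow> (nat set \<Rightarrow> bool) \<Rightarrow> nat set set" where
  "edge_set N \<epsilon> = {e \<in> pairs N. \<epsilon> e}"

definition loop_set :: "nat \<Rightarrow> (nat set \<Rightarrow> bool) \<Rightarrow> nat set set" where
  "loop_set N \<epsilon> = {e \<in> edge_set N \<epsilon>. \<exists>v. e = {v}}"

definition nbrs :: "nat \<Rightarrow> (nat set \<Rightarrow> bool) \<Rightarrow> nat \<Rightarrow> nat set" where
  "nbrs N \<epsilon> v = {w \<in> verts N. {v, w} \<in> edge_set N \<epsilon>}"

definition deg :: "nat \<Rightarrow> (nat set \<Rightarrow> bool) \<Rightarrow> nat \<Rightarrow> nat" where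
  "deg N \<epsilon> v = (\<Sum>w\<in>verts N. of_bool (\<epsilon> {v, w}))"

text \<open>
  From \<open>v\<close> the walk jumps to each neighbour with probability \<open>1 / deg N \<epsilon> v\<close>. At a vertex
  without any edge it stays put; this never happens in a connected graph on \<open>N \<ge> 2\<close> vertices.
\<close>

definition rw_step :: "nat \<Rightarrow> (nat set \<Rightarrow> bool) \<Rightarrow> nat \<Rightarrow> nat pmf" where
  "rw_step N \<epsilon> v = (if nbrs N \<epsilon> v = {} then return_pmf v else pmf_of_set (nbrs N \<epsilon> v))"

definition inv_dist :: "nat \<Rightarrow> (nat set \<Rightarrow> bool) \<Rightarrow> nat \<Rightarrow> real" where
  "inv_dist N \<epsilon> v =
     real (deg N \<epsilon> v) / (2 * real (card (edge_set N \<epsilon>)) - real (card (loop_set N \<epsilon>)))"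

text \<open>
  The law on trajectories \<open>nat \<Rightarrow> nat\<close> of the Markov chain with transition probabilities \<open>K\<close>
  started in \<open>v\<close>, obtained from the Ionescu-Tulcea theorem. The lemmas
  \<open>prob_space_chain_measure\<close> and \<open>emeasure_chain_measure_cylinder\<close> below characterize it.
\<close>

definition chain_kernel :: "(nat \<Rightarrow> nat pmf) \<Rightarrow> nat \<Rightarrow> nat \<Rightarrow> (nat \<Rightarrow> nat) \<Rightarrow> nat measure" where
  "chain_kernel K v i X = measure_pmf (case i of 0 \<Rightarrow> return_pmf v | Suc j \<Rightarrow> K (X j))"

definition chain_measure :: "(nat \<Rightarrow> nat pmf) \<Rightarrow> nat \<Rightarrow> (nat \<Rightarrow> nat) measure" where
  "chain_measure K v =
     projective_family.lim UNIV
       (Ionescu_Tulcea.CI (chain_kernel K v) (\<lambda>_. count_space UNIV)) (\<lambda>_. count_space UNIV)"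

definition hitting_time :: "nat \<Rightarrow> (nat \<Rightarrow> nat) \<Rightarrow> ennreal" where
  "hitting_time w X = (INF n\<in>{n. X n = w}. of_nat n)"

definition exp_hitting_time :: "nat \<Rightarrow> (nat set \<Rightarrow> bool) \<Rightarrow> nat \<Rightarrow> nat \<Rightarrow> ennreal" where
  "exp_hitting_time N \<epsilon> v w = (\<integral>\<^sup>+ X. hitting_time w X \<partial>chain_measure (rw_step N \<epsilon>) v)"

text \<open>The quantity \<open>H\<^sup>v\<close>. It may be infinite if the graph is not connected.\<close>

definition avg_hitting_time :: "nat \<Rightarrow> (nat set \<Rightarrow> bool) \<Rightarrow> nat \<Rightarrow> ennreal" where
  "avg_hitting_time N \<epsilon> v =
     (\<Sum>w\<in>verts N. ennreal (inv_dist N \<epsilon> w) * exp_hitting_time N \<epsilon> v w)"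


section \<open>The stochastic block model\<close>

text \<open>\<open>b v\<close> is the index of the block that contains the vertex \<open>v\<close>.\<close>

definition equal_blocks :: "nat \<Rightarrow> nat \<Rightarrow> (nat \<Rightarrow> nat) \<Rightarrow> bool" where
  "equal_blocks M N b \<longleftrightarrow>
     (\<forall>v\<in>verts N. b v \<in> {1..M}) \<and>
     (\<forall>m\<in>{1..M}. real (card {v \<in> verts N. b v = m}) = real N / real M)"

definition edge_prob :: "(nat \<Rightarrow> nat) \<Rightarrow> (nat \<Rightarrow> real) \<Rightarrow> real \<Rightarrow> nat set \<Rightarrow> real" where
  "edge_prob b p q e = (if is_singleton (b ` e) then p (the_elem (b ` e)) else q)"

definition sbm_pmf ::
  "nat \<Rightarrow> (nat \<Rightarrow> nat) \<Rightarrow> (nat \<Rightarrow> real) \<Rightarrow> real \<Rightarrow> (nat set \<Rightarrow> bool) pmf" where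
  "sbm_pmf N b p q = Pi_pmf (pairs N) False (\<lambda>e. bernoulli_pmf (edge_prob b p q e))"

definition exp_deg :: "nat \<Rightarrow> (nat \<Rightarrow> real) \<Rightarrow> real \<Rightarrow> nat \<Rightarrow> nat \<Rightarrow> real" where
  "exp_deg M p q N m = real N / real M * p m + (real M - 1) * (real N / real M) * q"

definition exp_deg_min :: "nat \<Rightarrow> (nat \<Rightarrow> real) \<Rightarrow> real \<Rightarrow> nat \<Rightarrow> real" where
  "exp_deg_min M p q N = Min (exp_deg M p q N ` {1..M})"

definition exp_deg_max :: "nat \<Rightarrow> (nat \<Rightarrow> real) \<Rightarrow> real \<Rightarrow> nat \<Rightarrow> real" where
  "exp_deg_max M p q N = Max (exp_deg M p q N ` {1..M})"

definition p_min :: "nat \<Rightarrow> (nat \<Rightarrow> real) \<Rightarrow> real" where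
  "p_min M p = Min (p ` {1..M})"

definition p_max :: "nat \<Rightarrow> (nat \<Rightarrow> real) \<Rightarrow> real" where
  "p_max M p = Max (p ` {1..M})"


section \<open>Asymptotics\<close>

text \<open>\<open>N\<close> tends to infinity through the multiples of \<open>M\<close> that exceed \<open>M\<close>.\<close>

definition multiples :: "nat \<Rightarrow> nat set" where
  "multiples M = {N. M dvd N \<and> M < N}"

definition at_multiples :: "nat \<Rightarrow> nat filter" where
  "at_multiples M = inf at_top (principal (multiples M))"

text \<open>
  \<open>f \<lless> g\<close>, i.e. \<open>f / g \<rightarrow> 0\<close>. Since \<open>x / 0 = 0\<close> in HOL, the quotient is explicitly
  required to be meaningful.
\<close>

definition much_less :: "(nat \<Rightarrow> real) \<Rightarrow> (nat \<Rightarrow> real) \<Rightarrow> nat filter \<Rightarrow> bool" where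
  "much_less f g F \<longleftrightarrow> (\<forall>\<^sub>F N in F. g N \<noteq> 0) \<and> ((\<lambda>N. f N / g N) \<longlongrightarrow> 0) F"

definition aas :: "nat filter \<Rightarrow> (nat \<Rightarrow> 'a pmf) \<Rightarrow> (nat \<Rightarrow> 'a \<Rightarrow> bool) \<Rightarrow> bool" where
  "aas F G A \<longleftrightarrow> ((\<lambda>N. measure_pmf.prob (G N) {\<omega>. A N \<omega>}) \<longlongrightarrow> 1) F"

text \<open>
  \<open>X N = x N * (1 + o(1))\<close> a.a.s. for a random variable \<open>X\<close> with values in \<open>[0, \<infinity>]\<close>;
  the event excludes \<open>X N = \<infinity>\<close>.
\<close>

definition aas_asymp ::
  "nat filter \<Rightarrow> (nat \<Rightarrow> 'a pmf) \<Rightarrow> (nat \<Rightarrow> 'a \<Rightarrow> ennreal) \<Rightarrow> (nat \<Rightarrow> real) \<Rightarrow> bool" where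
  "aas_asymp F G X x \<longleftrightarrow>
     (\<exists>\<delta> :: nat \<Rightarrow> real. (\<delta> \<longlongrightarrow> 0) F \<and>
        aas F G (\<lambda>N \<omega>. \<bar>enn2ereal (X N \<omega>) / ereal (x N) - 1\<bar> \<le> ereal (\<delta> N)))"


section \<open>Basic facts\<close>

lemma edge_prob_pair: "edge_prob b p q {v, w} = (if b v = b w then p (b v) else q)"
  by (auto simp: edge_prob_def is_singleton_def)

lemma deg_eq_card_nbrs:
  assumes "v \<in> verts N"
  shows "deg N \<epsilon> v = card (nbrs N \<epsilon> v)"
proof -
  have "nbrs N \<epsilon> v = {w \<in> verts N. \<epsilon> {v, w}}"
    using assms by (auto simp: nbrs_def edge_set_def pairs_def)
  thus ?thesis
    by (simp add: deg_def verts_def sum.If_cases of_bool_def Int_def)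
qed

lemma hitting_time_eq_Least:
  assumes "X n = w"
  shows "hitting_time w X = of_nat (LEAST n. X n = w)"
  unfolding hitting_time_def
  using assms by (intro antisym INF_lower INF_greatest) (auto intro: LeastI Least_le)

lemma hitting_time_eq_top: "(\<And>n. X n \<noteq> w) \<Longrightarrow> hitting_time w X = \<infinity>"
  by (simp add: hitting_time_def)

lemma Ionescu_Tulcea_chain_kernel:
  "Ionescu_Tulcea (chain_kernel K v) (\<lambda>_. count_space UNIV)"
proof (rule Ionescu_Tulcea.intro)
  fix i
  show "chain_kernel K v i \<in> measurable (PiM {0..<i} (\<lambda>_. count_space UNIV))
          (subprob_algebra (count_space UNIV))"
  proof (cases i)
    case 0
    then show ?thesis
      by (simp add: chain_kernel_def [abs_def] space_subprob_algebra
          measure_pmf.subprob_space_axioms)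
  next
    case (Suc j)
    have "(\<lambda>x. measure_pmf (K x)) \<in> measurable (count_space UNIV)
            (subprob_algebra (count_space UNIV))"
      by (simp add: space_subprob_algebra measure_pmf.subprob_space_axioms)
    moreover have "(\<lambda>X. X j) \<in> measurable (PiM {0..<i} (\<lambda>_. count_space UNIV))
            (count_space (UNIV :: nat set))"
      using Suc by (intro measurable_component_singleton) auto
    ultimately have "(\<lambda>X. measure_pmf (K (X j))) \<in> measurable (PiM {0..<i} (\<lambda>_. count_space UNIV))
            (subprob_algebra (count_space UNIV))"
      by (rule measurable_compose [rotated])
    then show ?thesis
      using Suc by (simp add: chain_kernel_def [abs_def])
  qed
next
  fix i and X :: "nat \<Rightarrow> nat"
  show "prob_space (chain_kernel K v i X)"
    by (simp add: chain_kernel_def measure_pmf.prob_space_axioms)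
qed

lemma sets_chain_measure:
  "sets (chain_measure K v) = sets (PiM UNIV (\<lambda>_. count_space UNIV))"
proof -
  interpret IT: Ionescu_Tulcea "chain_kernel K v" "\<lambda>_. count_space UNIV"
    by (rule Ionescu_Tulcea_chain_kernel)
  show ?thesis
    by (simp add: chain_measure_def)
qed

lemma emeasure_chain_measure_cylinder:
  "emeasure (chain_measure K v) {X. \<forall>i\<le>n. X i = x i} =
     ennreal (of_bool (x 0 = v) * (\<Prod>i<n. pmf (K (x i)) (x (Suc i))))"
proof -
  interpret IT: Ionescu_Tulcea "chain_kernel K v" "\<lambda>_. count_space UNIV"
    by (rule Ionescu_Tulcea_chain_kernel)
  let ?M = "\<lambda>_::nat. count_space (UNIV :: nat set)"
  let ?f = "\<lambda>i. pmf (case i of 0 \<Rightarrow> return_pmf v | Suc j \<Rightarrow> K (x j)) (x i)"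
  have sing: "{restrict x {0..<m}} \<in> sets (PiM {0..<m} ?M)" for m
  proof -
    have "PiE {0..<m} (\<lambda>i. {x i}) = PiE {0..<m} (\<lambda>i. {restrict x {0..<m} i})"
      by (rule PiE_cong) simp
    also have "\<dots> = {restrict x {0..<m}}"
      by (rule PiE_singleton) (rule restrict_extensional)
    finally have "{restrict x {0..<m}} = PiE {0..<m} (\<lambda>i. {x i})" ..
    then show ?thesis
      using sets_PiM_I_finite[of "{0..<m}" "\<lambda>i. {x i}" ?M] by (simp del: insert_iff)
  qed
  have C: "emeasure (IT.C 0 m (\<lambda>_. undefined)) {restrict x {0..<m}} = ennreal (\<Prod>i<m. ?f i)" for m
  proof (induction m)
    case 0
    have "restrict x {0..<0} = (\<lambda>_. undefined)"
      by auto
    then show ?case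
      using sing[of 0] by simp
  next
    case (Suc m)
    let ?C = "IT.C 0 m (\<lambda>_. undefined)"
    have un: "(\<lambda>_. undefined) \<in> space (PiM {0..<0} ?M)"
      by (simp add: space_PiM)
    have sp: "space ?C = space (PiM {0..<m} ?M)" and se: "sets ?C = sets (PiM {0..<m} ?M)"
      using IT.space_C[OF un, of m] IT.sets_C[OF un, of m] by simp_all
    have step: "emeasure (IT.eP m X) {restrict x {0..<Suc m}} =
        ennreal (?f m) * indicator {restrict x {0..<m}} X" if X: "X \<in> space ?C" for X
    proof -
      from X have X': "X \<in> space (PiM {0..<m} ?M)" by (simp add: sp)
      then have ext: "X \<in> extensional {0..<m}"
        by (auto simp: space_PiM PiE_def)
      have eq: "X(m := y) = restrict x {0..<Suc m} \<longleftrightarrow> X = restrict x {0..<m} \<and> y = x m" for y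
      proof
        assume A: "X(m := y) = restrict x {0..<Suc m}"
        have "X i = restrict x {0..<m} i" for i
          using fun_cong[OF A, of i] ext by (cases "i < m") (auto simp: extensional_def)
        moreover have "y = x m"
          using fun_cong[OF A, of m] by simp
        ultimately show "X = restrict x {0..<m} \<and> y = x m" by auto
      qed (auto simp: fun_eq_iff restrict_def)
      have "emeasure (IT.eP m X) {restrict x {0..<Suc m}} =
          emeasure (chain_kernel K v m X) {y. X = restrict x {0..<m} \<and> y = x m}"
        using IT.emeasure_eP[OF X' sing[of "Suc m"]] by (simp add: vimage_def eq)
      also have "\<dots> = ennreal (?f m) * indicator {restrict x {0..<m}} X"
        by (cases "X = restrict x {0..<m}"; cases m)
           (auto simp: chain_kernel_def emeasure_pmf_single)
      finally show ?thesis .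
    qed
    have "emeasure (IT.C 0 (Suc m) (\<lambda>_. undefined)) {restrict x {0..<Suc m}} =
        (\<integral>\<^sup>+ X. emeasure (IT.eP m X) {restrict x {0..<Suc m}} \<partial>?C)"
      using IT.prob_space_C[OF un, of m, THEN prob_space.not_empty]
      by (simp, intro emeasure_bind[where N = "PiM {0..<Suc m} ?M"])
         (auto simp: sing measurable_cong_sets[OF se refl])
    also have "\<dots> = (\<integral>\<^sup>+ X. ennreal (?f m) * indicator {restrict x {0..<m}} X \<partial>?C)"
      by (intro nn_integral_cong step)
    also have "\<dots> = ennreal (?f m) * emeasure ?C {restrict x {0..<m}}"
      using sing[of m] by (intro nn_integral_cmult_indicator) (simp add: se)
    also have "\<dots> = ennreal (\<Prod>i<Suc m. ?f i)"
      unfolding Suc.IH by (subst ennreal_mult'[symmetric]) (auto simp: mult.commute prod_nonneg)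
    finally show ?case .
  qed
  have cyl: "{X. \<forall>i\<le>n. X i = x i} = IT.PF.emb UNIV {0..<Suc n} {restrict x {0..<Suc n}}"
    by (auto simp: prod_emb_def space_PiM fun_eq_iff restrict_def less_Suc_eq_le) metis
  have "emeasure (chain_measure K v) {X. \<forall>i\<le>n. X i = x i} =
      emeasure (IT.CI {0..<Suc n}) {restrict x {0..<Suc n}}"
    unfolding chain_measure_def cyl using sing[of "Suc n"] by (intro IT.lim) auto
  also have "\<dots> = emeasure (IT.C 0 (Suc n) (\<lambda>_. undefined)) {restrict x {0..<Suc n}}"
    using IT.emeasure_CI[OF subset_refl sing[of "Suc n"]] sing[of "Suc n"]
      prod_emb_id[of "{restrict x {0..<Suc n}}" "{0..<Suc n}" ?M]
    by (simp del: IT.C.simps add: sets.sets_into_space PiE_def Pi_def extensional_def)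
  also have "\<dots> = ennreal (\<Prod>i<Suc n. ?f i)"
    by (rule C)
  also have "(\<Prod>i<Suc n. ?f i) = of_bool (x 0 = v) * (\<Prod>i<n. pmf (K (x i)) (x (Suc i)))"
    by (subst prod.lessThan_Suc_shift) (simp add: pmf_return)
  finally show ?thesis .
qed

lemma prob_space_chain_measure: "prob_space (chain_measure K v)"
proof -
  interpret IT: Ionescu_Tulcea "chain_kernel K v" "\<lambda>_. count_space UNIV"
    by (rule Ionescu_Tulcea_chain_kernel)
  have "distr (chain_measure K v) (PiM {0} (\<lambda>_. count_space UNIV)) (\<lambda>f. restrict f {0}) = IT.CI {0}"
    unfolding chain_measure_def by (rule IT.distr_lim) auto
  moreover have "prob_space (IT.CI {0})"
    by (rule IT.PF.prob_space_P) auto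
  ultimately show ?thesis
    by (intro prob_space_distrD[of "\<lambda>f. restrict f {0}" "chain_measure K v"
          "PiM {0} (\<lambda>_. count_space UNIV)"])
       (auto intro!: measurable_restrict measurable_component_singleton
         simp: measurable_cong_sets[OF sets_chain_measure refl])
qed

end

theory Submission
  imports Defs
begin

text \<open>
  By the random target lemma, \<open>H\<^sup>v\<close> does not depend on \<open>v\<close>: it is the trace of the
  Green operator \<open>(1 - P)\<^sup>-\<^sup>1\<close> on the functions of mean zero. Since
  \<open>(1 - P)\<^sup>-\<^sup>1 = 1 + P + P (1 - P)\<^sup>-\<^sup>1 P\<close> and the trace of \<open>P\<^sup>2\<close> is at most
  \<open>N / d_min\<close>, it lies between \<open>N - 2\<close> and \<open>N (1 + 1 / d_min + 1 / (d_min * gap))\<close>, so it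
  suffices that \<open>d_min\<close> and \<open>d_min * gap\<close> tend to infinity. For the gap only the order of magnitude
  matters. By Cheeger's inequality for the graph of the edges between different blocks, whose cuts
  are large by a Chernoff bound and a union bound over all vertex sets, the gap is at least a
  constant times \<open>\<mu> / \<gamma>_max\<close>, where \<open>\<mu>\<close> is the expected number of neighbours in other blocks.
  The two growth conditions give \<open>\<mu> \<ge> log\<^sup>3 N\<close> and \<open>\<gamma>_max / (\<gamma>_min * \<mu>) \<rightarrow> 0\<close>.
\<close>

section \<open>Dirichlet forms and the random target lemma\<close>

text \<open>The obstacle is heterogeneity: the \<open>p_m\<close> may differ widely, so degrees
  range from order gamma_min to order gamma_max. The edges between different blocks do not see this,
  because every vertex has the same expected number \<mu> of them. In the graph they form, degrees
  are at most 4\<mu> and a set of at most half of the vertices has boundary at least \<mu>/8 per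
  vertex. Cheeger's inequality with vertices counted uniformly then gives a gap of order \<mu> and
  loses only a constant. Edges inside the blocks can only increase the Dirichlet form; they enter
  through the normalization by degrees, which are at most 4 gamma_max, whence a gap of \<mu>/(2048
  gamma_max). Such a crude bound suffices because the gap occurs only in the correction 1/(d_min *
  gap), not in the leading term N. No eigenvalues are used: the trace is evaluated target by target,
  and the gap is expressed by a Poincare inequality.\<close>

locale weighted_graph =
  fixes V :: "'a set" and a :: "'a \<Rightarrow> 'a \<Rightarrow> real"
  assumes finite_V [simp]: "finite V"
    and a_sym: "a v w = a w v"
    and a_nonneg [simp]: "0 \<le> a v w"
begin

text \<open>A loop \<open>a v v\<close> counts once, in agreement with \<open>deg\<close>; it drops
  out of \<open>lap\<close> and \<open>energy\<close>.\<close>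

definition wdeg :: "'a \<Rightarrow> real" where
  "wdeg v = (\<Sum>w\<in>V. a v w)"

definition total_deg :: real where
  "total_deg = (\<Sum>v\<in>V. wdeg v)"

text \<open>With P the transition operator, this is \<open>wdeg\<close> times 1 - P. The factor
  makes it symmetric, and the equation h = 1 + P h of the hitting times becomes
  \<open>lap h v = wdeg v\<close>.\<close>

definition lap :: "('a \<Rightarrow> real) \<Rightarrow> 'a \<Rightarrow> real" where
  "lap f v = (\<Sum>w\<in>V. a v w * (f v - f w))"

definition energy :: "('a \<Rightarrow> real) \<Rightarrow> real" where
  "energy f = (\<Sum>v\<in>V. f v * lap f v)"

lemma wdeg_nonneg: "0 \<le> wdeg v"
  by (simp add: wdeg_def sum_nonneg)

lemma lap_eq: "lap f v = wdeg v * f v - (\<Sum>w\<in>V. a v w * f w)"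
  by (simp add: lap_def wdeg_def algebra_simps sum_subtractf sum_distrib_left)

lemma lap_diff: "lap (\<lambda>v. f v - g v) v = lap f v - lap g v"
  by (simp add: lap_def algebra_simps sum_subtractf sum.distrib)

lemma lap_const: "lap (\<lambda>v. c) v = 0"
  by (simp add: lap_def)

lemma lap_sum: "lap (\<lambda>v. \<Sum>i\<in>I. c i * f i v) v = (\<Sum>i\<in>I. c i * lap (f i) v)"
proof -
  have "lap (\<lambda>v. \<Sum>i\<in>I. c i * f i v) v = (\<Sum>w\<in>V. \<Sum>i\<in>I. c i * (a v w * (f i v - f i w)))"
    by (simp add: lap_def sum_subtractf [symmetric] sum_distrib_left algebra_simps)
  also have "\<dots> = (\<Sum>i\<in>I. c i * lap (f i) v)"
    by (subst sum.swap) (simp add: lap_def sum_distrib_left)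
  finally show ?thesis .
qed

lemma sum_sym: "(\<Sum>v\<in>V. \<Sum>w\<in>V. a v w * F v w) = (\<Sum>v\<in>V. \<Sum>w\<in>V. a v w * F w v)"
  by (subst sum.swap) (simp add: a_sym)

text \<open>This is reversibility of the walk with respect to the degrees.\<close>

lemma lap_selfadjoint: "(\<Sum>v\<in>V. f v * lap g v) = (\<Sum>v\<in>V. g v * lap f v)"
proof -
  have "(\<Sum>v\<in>V. \<Sum>w\<in>V. a v w * (f v * g w)) = (\<Sum>v\<in>V. \<Sum>w\<in>V. a v w * (g v * f w))"
    by (subst sum_sym) (simp add: mult.commute)
  then show ?thesis
    by (simp add: lap_eq algebra_simps sum_subtractf sum_distrib_left)
qed

lemma sum_lap: "(\<Sum>v\<in>V. lap f v) = 0"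
  using lap_selfadjoint[of "\<lambda>_. 1" f] by (simp add: lap_const)

lemma energy_eq: "2 * energy f = (\<Sum>v\<in>V. \<Sum>w\<in>V. a v w * (f v - f w)\<^sup>2)"
proof -
  have "energy f = (\<Sum>v\<in>V. \<Sum>w\<in>V. a v w * (f v * (f v - f w)))"
    by (simp add: energy_def lap_def sum_distrib_left mult.left_commute)
  moreover from this have "energy f = (\<Sum>v\<in>V. \<Sum>w\<in>V. a v w * (f w * (f w - f v)))"
    by (subst (asm) sum_sym)
  ultimately have "2 * energy f =
      (\<Sum>v\<in>V. \<Sum>w\<in>V. a v w * (f v * (f v - f w)) + a v w * (f w * (f w - f v)))"
    by (simp add: sum.distrib)
  also have "\<dots> = (\<Sum>v\<in>V. \<Sum>w\<in>V. a v w * (f v - f w)\<^sup>2)"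
    by (intro sum.cong refl) (simp add: power2_eq_square algebra_simps)
  finally show ?thesis .
qed

lemma energy_nonneg: "0 \<le> energy f"
proof -
  have "0 \<le> 2 * energy f"
    unfolding energy_eq by (intro sum_nonneg mult_nonneg_nonneg) auto
  then show ?thesis by simp
qed

lemma energy_shift: "energy (\<lambda>v. f v - c) = energy f"
  using energy_eq[of f] energy_eq[of "\<lambda>v. f v - c"] by simp

lemma sum_wdeg_neighbours: "(\<Sum>v\<in>V. \<Sum>w\<in>V. a v w * g w) = (\<Sum>v\<in>V. wdeg v * g v)"
  by (subst sum_sym) (simp add: wdeg_def sum_distrib_right)

end

section \<open>Consequences of a Poincare inequality\<close>

text \<open>\<open>gap\<close> is a lower bound for the spectral gap of 1 - P in the space weighted
  by degrees, stated variationally. Its positivity contains connectedness: the centered indicator of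
  a component would have energy 0.\<close>

locale poincare_graph = weighted_graph +
  fixes gap :: real
  assumes wdeg_pos: "v \<in> V \<Longrightarrow> 0 < wdeg v"
    and gap_pos: "0 < gap"
    and poincare: "(\<Sum>v\<in>V. wdeg v * f v) = 0 \<Longrightarrow> gap * (\<Sum>v\<in>V. wdeg v * (f v)\<^sup>2) \<le> energy f"
begin

lemma total_deg_pos: "v \<in> V \<Longrightarrow> 0 < total_deg"
  unfolding total_deg_def by (intro sum_pos2[of V v] wdeg_nonneg) (auto simp: wdeg_pos)

definition mean :: "('a \<Rightarrow> real) \<Rightarrow> real" where
  "mean f = (\<Sum>v\<in>V. wdeg v * f v) / total_deg"

lemma sum_wdeg_eq_mean: "V \<noteq> {} \<Longrightarrow> (\<Sum>v\<in>V. wdeg v * f v) = total_deg * mean f"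
  using total_deg_pos by (fastforce simp: mean_def)

lemma centered: "V \<noteq> {} \<Longrightarrow> (\<Sum>v\<in>V. wdeg v * (f v - mean f)) = 0"
  by (simp add: right_diff_distrib sum_subtractf sum_wdeg_eq_mean total_deg_def flip: sum_distrib_right)

lemma poincare_mean:
  "V \<noteq> {} \<Longrightarrow> gap * (\<Sum>v\<in>V. wdeg v * (f v - mean f)\<^sup>2) \<le> energy f"
  using poincare[OF centered] by (simp add: energy_shift)

text \<open>Zero Laplacian means zero energy, hence zero variance by the Poincare inequality. This
  takes the place of the maximum principle.\<close>

lemma harmonic_eq_mean:
  assumes "v \<in> V" and "\<And>u. u \<in> V \<Longrightarrow> lap f u = 0"
  shows "f v = mean f"
proof -
  have "energy f = 0"
    using assms(2) by (simp add: energy_def)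
  then have "gap * (\<Sum>v\<in>V. wdeg v * (f v - mean f)\<^sup>2) \<le> 0"
    using poincare_mean[of f] assms(1) by auto
  then have "(\<Sum>v\<in>V. wdeg v * (f v - mean f)\<^sup>2) \<le> 0"
    using gap_pos by (simp add: mult_le_0_iff)
  moreover have "wdeg v * (f v - mean f)\<^sup>2 \<le> (\<Sum>v\<in>V. wdeg v * (f v - mean f)\<^sup>2)"
    using assms(1) by (intro member_le_sum) (auto simp: wdeg_nonneg)
  ultimately have "wdeg v * (f v - mean f)\<^sup>2 \<le> 0"
    by linarith
  then show ?thesis
    using wdeg_pos[OF assms(1)] by (simp add: mult_le_0_iff)
qed

text \<open>
  Applied to the truncated hitting times, this yields finite expected hitting times from the spectral
  gap alone, without a separate connectivity argument.
\<close>

lemma subsolution_bounded: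
  assumes w: "w \<in> V" and "s w = 0" and pos: "\<And>v. v \<in> V \<Longrightarrow> 0 \<le> s v"
    and sub: "\<And>v. v \<in> V \<Longrightarrow> v \<noteq> w \<Longrightarrow> lap s v \<le> wdeg v"
    and v: "v \<in> V"
  shows "s v \<le> total_deg * (total_deg / (gap * wdeg w)) / wdeg v"
proof -
  have ne: "V \<noteq> {}" and D: "0 < total_deg" and dw: "0 < wdeg w" and dv: "0 < wdeg v"
    using w v total_deg_pos wdeg_pos by auto
  define c where "c = mean s"
  have sum: "(\<Sum>v\<in>V. wdeg v * s v) = total_deg * c"
    unfolding c_def by (rule sum_wdeg_eq_mean[OF ne])
  have "energy s \<le> (\<Sum>v\<in>V. s v * wdeg v)"
    unfolding energy_def
  proof (rule sum_mono)
    fix u assume u: "u \<in> V"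
    show "s u * lap s u \<le> s u * wdeg u"
      using assms(2) sub[OF u] pos[OF u] by (cases "u = w") (auto intro: mult_left_mono)
  qed
  then have e: "energy s \<le> total_deg * c"
    using sum by (simp add: mult.commute)
  \<comment> \<open>Since \<open>s w = 0\<close>, the vertex \<open>w\<close> alone contributes
    \<open>wdeg w\<close> times the squared mean to the variance. The energy is only linear in the
    mean, so the mean is bounded.\<close>
  have "wdeg w * c\<^sup>2 \<le> (\<Sum>v\<in>V. wdeg v * (s v - c)\<^sup>2)"
    using member_le_sum[of w V "\<lambda>v. wdeg v * (s v - c)\<^sup>2"] w assms(2) by (simp add: wdeg_nonneg)
  then have "gap * (wdeg w * c\<^sup>2) \<le> gap * (\<Sum>v\<in>V. wdeg v * (s v - c)\<^sup>2)"
    using gap_pos by simp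
  also have "\<dots> \<le> total_deg * c"
    using poincare_mean[OF ne, of s] e by (simp add: c_def)
  finally have q: "c * (gap * wdeg w * c) \<le> c * total_deg"
    by (simp add: power2_eq_square ac_simps)
  have "c \<le> total_deg / (gap * wdeg w)"
  proof (cases "0 < c")
    case True
    with q have "gap * wdeg w * c \<le> total_deg" by simp
    then show ?thesis using gap_pos dw by (simp add: field_simps)
  next
    case False
    have "0 \<le> total_deg / (gap * wdeg w)" using gap_pos dw D by simp
    with False show ?thesis by linarith
  qed
  then have "total_deg * c \<le> total_deg * (total_deg / (gap * wdeg w))"
    using D by (intro mult_left_mono) auto
  moreover have "wdeg v * s v \<le> total_deg * c"
    unfolding sum[symmetric] using v by (intro member_le_sum) (auto simp: pos wdeg_nonneg)
  ultimately have "s v * wdeg v \<le> total_deg * (total_deg / (gap * wdeg w))"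
    by (metis mult.commute order_trans)
  then show ?thesis
    using dv by (simp only: pos_le_divide_eq)
qed

text \<open>The quadratic form of the Green operator at \<open>u\<close> is at most the squared norm
  of \<open>u\<close> over \<open>gap\<close>. Young's inequality with weight \<open>gap\<close>
  bounds the energy by half of itself plus half of the right-hand side, so no spectral decomposition
  is needed.\<close>

lemma energy_le_if_lap_eq:
  assumes x: "\<And>v. v \<in> V \<Longrightarrow> lap x v = wdeg v * u v"
    and x0: "(\<Sum>v\<in>V. wdeg v * x v) = 0"
  shows "energy x \<le> (\<Sum>v\<in>V. wdeg v * (u v)\<^sup>2) / gap"
proof -
  have e: "energy x = (\<Sum>v\<in>V. wdeg v * (x v * u v))"
    unfolding energy_def by (intro sum.cong) (auto simp: x)
  have "(\<Sum>v\<in>V. wdeg v * (x v * u v))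
      \<le> (\<Sum>v\<in>V. wdeg v * (gap * (x v)\<^sup>2 + (u v)\<^sup>2 / gap) / 2)"
  proof (rule sum_mono)
    fix v
    have "0 \<le> (gap * x v - u v)\<^sup>2 / gap" using gap_pos by simp
    also have "\<dots> = gap * (x v)\<^sup>2 + (u v)\<^sup>2 / gap - 2 * (x v * u v)"
      using gap_pos by (simp add: power2_eq_square field_simps)
    finally have "x v * u v \<le> (gap * (x v)\<^sup>2 + (u v)\<^sup>2 / gap) / 2" by simp
    from mult_left_mono[OF this wdeg_nonneg[of v]]
    show "wdeg v * (x v * u v) \<le> wdeg v * (gap * (x v)\<^sup>2 + (u v)\<^sup>2 / gap) / 2" by simp
  qed
  also have "\<dots> = (gap * (\<Sum>v\<in>V. wdeg v * (x v)\<^sup>2) + (\<Sum>v\<in>V. wdeg v * (u v)\<^sup>2) / gap) / 2"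
    by (simp add: sum_divide_distrib sum_distrib_left sum.distrib[symmetric] algebra_simps)
  finally show ?thesis
    using poincare[OF x0] e by simp
qed

text \<open>The value at the target is forced, because a Laplacian sums to 0 over \<open>V\<close>.
  When \<open>h w = 0\<close> it is Kac's formula: the mean return time to \<open>w\<close> is
  \<open>total_deg / wdeg w\<close>.\<close>

lemma lap_hitting_time:
  assumes w: "w \<in> V" and h: "\<And>v. v \<in> V \<Longrightarrow> v \<noteq> w \<Longrightarrow> lap h v = wdeg v" and v: "v \<in> V"
  shows "lap h v = wdeg v - (if v = w then total_deg else 0)"
proof (cases "v = w")
  case True
  have "0 = lap h w + (\<Sum>v\<in>V-{w}. lap h v)"
    using sum.remove[OF finite_V w, of "lap h"] sum_lap[of h] by simp
  also have "(\<Sum>v\<in>V-{w}. lap h v) = (\<Sum>v\<in>V-{w}. wdeg v)"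
    by (intro sum.cong) (auto simp: h)
  also have "\<dots> = total_deg - wdeg w"
    unfolding total_deg_def using sum.remove[OF finite_V w, of wdeg] by simp
  finally show ?thesis using True by simp
qed (use h v in auto)

text \<open>
  Writing \<open>P\<close> for the transition operator, \<open>f = mean h - h\<close> solves \<open>(1 - P) f = g\<close> with
  \<open>g = \<delta>\<^sub>w / \<pi>\<^sub>w - 1\<close>. Expanding \<open>\<langle>f, g\<rangle>\<close> twice by \<open>f = g + P f\<close> isolates the explicit terms
  \<open>\<langle>g, g\<rangle> + \<langle>g, P g\<rangle>\<close>; the remainder is the energy of \<open>x = P f\<close>.
\<close>

lemma mean_hitting_time:
  assumes w: "w \<in> V" and hw: "h w = 0" and h: "\<And>v. v \<in> V \<Longrightarrow> v \<noteq> w \<Longrightarrow> lap h v = wdeg v"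
    and a1: "\<And>v. v \<in> V \<Longrightarrow> a v w \<le> 1" and dmin: "0 < dmin" "\<And>v. v \<in> V \<Longrightarrow> dmin \<le> wdeg v"
  shows "1 - 2 * (wdeg w / total_deg) \<le> wdeg w / total_deg * mean h"
    and "wdeg w / total_deg * mean h \<le> 1 + 1 / dmin + 1 / (dmin * gap)"
proof -
  have ne: "V \<noteq> {}" and D: "0 < total_deg" and dw: "0 < wdeg w"
    using w total_deg_pos wdeg_pos by auto
  let ?D = total_deg and ?d = "wdeg w"
  define f where "f v = mean h - h v" for v
  define g where "g v = (if v = w then ?D / ?d else 0) - 1" for v
  \<comment> \<open>\<open>u\<close> is P g. As \<open>x\<close> will be P f, the identity
    \<open>lx\<close> below says (1 - P) P f = P g.\<close>
  define u where "u v = a v w / wdeg v * (?D / ?d) - 1" for v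
  define x where "x v = f v - g v" for v
  have lf: "lap f v = wdeg v * g v" if "v \<in> V" for v
    using lap_diff[of "\<lambda>_. mean h" h v] lap_hitting_time[OF w h that] dw
    by (simp add: f_def[abs_def] g_def lap_const field_simps)
  have lg: "lap g v = wdeg v * (g v - u v)" if "v \<in> V" for v
  proof -
    have "(\<Sum>y\<in>V. a v y * g y) = (\<Sum>y\<in>V. (if y = w then a v w * (?D / ?d) else 0) - a v y)"
      by (intro sum.cong) (auto simp: g_def algebra_simps)
    also have "\<dots> = a v w * (?D / ?d) - wdeg v"
      using w by (simp add: sum_subtractf wdeg_def)
    finally have "(\<Sum>y\<in>V. a v y * g y) = a v w * (?D / ?d) - wdeg v" .
    then show ?thesis
      using wdeg_pos[OF that] by (simp add: lap_eq u_def field_simps)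
  qed
  have lx: "lap x v = wdeg v * u v" if "v \<in> V" for v
    using lap_diff[of f g v] lf[OF that] lg[OF that] by (simp add: x_def[abs_def] algebra_simps)
  have f0: "(\<Sum>v\<in>V. wdeg v * f v) = 0"
    using centered[OF ne, of h] by (simp add: f_def algebra_simps sum_subtractf)
  \<comment> \<open>\<open>g\<close> is the centered point mass at \<open>w\<close>: pairing with it
    evaluates at \<open>w\<close> and subtracts the mean, up to the factor
    \<open>total_deg\<close>.\<close>
  have gsum: "(\<Sum>v\<in>V. wdeg v * (y v * g v)) = ?D * y w - (\<Sum>v\<in>V. wdeg v * y v)" for y
  proof -
    have "(\<Sum>v\<in>V. wdeg v * (y v * g v))
        = (\<Sum>v\<in>V. (if v = w then wdeg w * y w * (?D / ?d) else 0)) - (\<Sum>v\<in>V. wdeg v * y v)"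
      unfolding sum_subtractf[symmetric] by (intro sum.cong) (auto simp: g_def algebra_simps)
    then show ?thesis using w dw by simp
  qed
  have g0: "(\<Sum>v\<in>V. wdeg v * g v) = 0"
    using gsum[of "\<lambda>_. 1"] by (simp add: total_deg_def)
  have x0: "(\<Sum>v\<in>V. wdeg v * x v) = 0"
    using f0 g0 by (simp add: x_def algebra_simps sum_subtractf)
  have asum: "(\<Sum>v\<in>V. a v w) = ?d"
    by (simp add: wdeg_def a_sym)
  have u0: "(\<Sum>v\<in>V. wdeg v * u v) = 0"
  proof -
    have "(\<Sum>v\<in>V. wdeg v * u v) = (\<Sum>v\<in>V. a v w * (?D / ?d) - wdeg v)"
      by (intro sum.cong) (use wdeg_pos in \<open>force simp: u_def field_simps\<close>)+
    also have "\<dots> = 0"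
      using dw by (simp add: sum_subtractf asum flip: total_deg_def sum_distrib_right sum_divide_distrib)
    finally show ?thesis .
  qed
  \<comment> \<open>In the product weighted by degrees, <f, g> = <f, P g> + <f, (1 - P) g>. The last
    term is <(1 - P) f, g> = <g, g>. With f = g + x and P g = (1 - P) x, the first one is <g, P g>
    plus the energy of \<open>x\<close>.\<close>
  have "?D * f w = (\<Sum>v\<in>V. wdeg v * (f v * g v))"
    using gsum[of f] f0 by simp
  also have "\<dots> = (\<Sum>v\<in>V. f v * lap x v) + (\<Sum>v\<in>V. wdeg v * (f v * (g v - u v)))"
    unfolding sum.distrib[symmetric] by (intro sum.cong) (auto simp: lx algebra_simps)
  also have "(\<Sum>v\<in>V. wdeg v * (f v * (g v - u v))) = (\<Sum>v\<in>V. f v * lap g v)"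
    by (intro sum.cong) (auto simp: lg)
  also have "\<dots> = (\<Sum>v\<in>V. g v * lap f v)"
    by (rule lap_selfadjoint)
  also have "\<dots> = (\<Sum>v\<in>V. wdeg v * (g v * g v))"
    by (intro sum.cong) (auto simp: lf)
  also have "\<dots> = ?D * g w"
    using gsum[of g] g0 by simp
  also have "(\<Sum>v\<in>V. f v * lap x v) = (\<Sum>v\<in>V. wdeg v * (u v * g v)) + energy x"
    unfolding energy_def sum.distrib[symmetric]
    by (intro sum.cong) (auto simp: lx x_def algebra_simps)
  also have "(\<Sum>v\<in>V. wdeg v * (u v * g v)) = ?D * u w"
    using gsum[of u] u0 by simp
  finally have "?D * mean h = ?D * u w + energy x + ?D * g w"
    by (simp add: f_def hw)
  then have "mean h = u w + energy x / ?D + g w"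
    using D by (simp add: field_simps)
  then have "?d / ?D * mean h = ?d / ?D * (u w + energy x / ?D + g w)"
    by (rule arg_cong)
  also have "\<dots> = 1 - 2 * (?d / ?D) + a w w / ?d + ?d / ?D\<^sup>2 * energy x"
    using D dw by (simp add: u_def g_def field_simps power2_eq_square)
  finally have main: "?d / ?D * mean h = 1 - 2 * (?d / ?D) + a w w / ?d + ?d / ?D\<^sup>2 * energy x" .
  show "1 - 2 * (?d / ?D) \<le> ?d / ?D * mean h"
    unfolding main using D dw energy_nonneg[of x] by simp
  \<comment> \<open>As \<open>u\<close> has mean zero, replacing it by \<open>u + 1\<close>
    increases the squared norm by \<open>total_deg\<close> and leaves a pure power of
    \<open>a v w\<close>. After scaling this is the diagonal entry of P squared at
    \<open>w\<close>.\<close>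
  have "(\<Sum>v\<in>V. wdeg v * (u v)\<^sup>2) \<le> (\<Sum>v\<in>V. wdeg v * (u v)\<^sup>2 + 2 * (wdeg v * u v) + wdeg v)"
    using D by (simp add: sum.distrib sum_distrib_left[symmetric] u0 total_deg_def[symmetric])
  also have "\<dots> = (\<Sum>v\<in>V. (a v w)\<^sup>2 / wdeg v * (?D / ?d)\<^sup>2)"
  proof (intro sum.cong refl)
    fix v assume v: "v \<in> V"
    have "wdeg v * (u v)\<^sup>2 + 2 * (wdeg v * u v) + wdeg v = wdeg v * (u v + 1)\<^sup>2"
      by (simp add: power2_eq_square algebra_simps)
    also have "\<dots> = (a v w)\<^sup>2 / wdeg v * (?D / ?d)\<^sup>2"
      using wdeg_pos[OF v] by (simp add: u_def power2_eq_square ac_simps)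
    finally show "wdeg v * (u v)\<^sup>2 + 2 * (wdeg v * u v) + wdeg v = (a v w)\<^sup>2 / wdeg v * (?D / ?d)\<^sup>2" .
  qed
  also have "\<dots> \<le> (\<Sum>v\<in>V. a v w / dmin * (?D / ?d)\<^sup>2)"
  proof (intro sum_mono mult_right_mono)
    fix v assume v: "v \<in> V"
    have "(a v w)\<^sup>2 \<le> a v w"
      using a1[OF v] a_nonneg[of v w] by (simp add: power2_eq_square mult_left_le)
    then show "(a v w)\<^sup>2 / wdeg v \<le> a v w / dmin"
      using dmin(1) dmin(2)[OF v] by (intro frac_le) auto
  qed auto
  also have "\<dots> = ?D\<^sup>2 / (?d * dmin)"
    using dw dmin(1)
    by (simp add: sum_distrib_right[symmetric] sum_divide_distrib[symmetric] asum power2_eq_square)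
  finally have "(\<Sum>v\<in>V. wdeg v * (u v)\<^sup>2) / gap \<le> ?D\<^sup>2 / (?d * dmin) / gap"
    using gap_pos by (intro divide_right_mono) auto
  with energy_le_if_lap_eq[OF lx x0] have "energy x \<le> ?D\<^sup>2 / (?d * dmin) / gap"
    by linarith
  then have "?d / ?D\<^sup>2 * energy x \<le> ?d / ?D\<^sup>2 * (?D\<^sup>2 / (?d * dmin) / gap)"
    using dw by (intro mult_left_mono) auto
  also have "\<dots> = 1 / (dmin * gap)"
    using dw D by simp
  finally have "?d / ?D\<^sup>2 * energy x \<le> 1 / (dmin * gap)" .
  moreover have "a w w / ?d \<le> 1 / dmin"
    using a1[OF w] dmin(1) dmin(2)[OF w] by (intro frac_le) auto
  moreover have "0 \<le> ?d / ?D"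
    using dw D by simp
  ultimately show "?d / ?D * mean h \<le> 1 + 1 / dmin + 1 / (dmin * gap)"
    unfolding main by linarith
qed

text \<open>Averaged over targets with the invariant weights, the point charges
  \<open>total_deg\<close> of \<open>lap_hitting_time\<close> add up to \<open>wdeg u\<close> at
  each \<open>u\<close> and cancel the source term. The average is harmonic in the starting point,
  hence constant.\<close>

lemma random_target:
  assumes h: "\<And>w v. w \<in> V \<Longrightarrow> v \<in> V \<Longrightarrow> v \<noteq> w \<Longrightarrow> lap (h w) v = wdeg v" and v: "v \<in> V"
  shows "(\<Sum>w\<in>V. wdeg w / total_deg * h w v) = (\<Sum>w\<in>V. wdeg w / total_deg * mean (h w))"
proof -
  define K where "K v = (\<Sum>w\<in>V. wdeg w / total_deg * h w v)" for v
  have D: "0 < total_deg" using total_deg_pos v .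
  have "lap K u = 0" if u: "u \<in> V" for u
  proof -
    have "lap K u = (\<Sum>w\<in>V. wdeg w / total_deg * lap (h w) u)"
      unfolding K_def[abs_def] by (rule lap_sum)
    also have "\<dots> = (\<Sum>w\<in>V. wdeg w / total_deg * wdeg u - (if u = w then wdeg u else 0))"
      using D by (intro sum.cong) (auto simp: lap_hitting_time[OF _ h u] field_simps)
    also have "\<dots> = (\<Sum>w\<in>V. wdeg w) / total_deg * wdeg u - wdeg u"
      using u by (simp add: sum_subtractf sum_distrib_right[symmetric] sum_divide_distrib[symmetric])
    also have "\<dots> = 0"
      using D by (simp add: total_deg_def[symmetric])
    finally show ?thesis .
  qed
  then have "K v = mean K"
    by (rule harmonic_eq_mean[OF v])
  also have "mean K = (\<Sum>v\<in>V. \<Sum>w\<in>V. wdeg w / total_deg * (wdeg v * h w v / total_deg))"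
    by (simp add: mean_def K_def sum_distrib_left sum_divide_distrib ac_simps)
  also have "\<dots> = (\<Sum>w\<in>V. wdeg w / total_deg * mean (h w))"
    by (subst sum.swap) (simp add: mean_def sum_distrib_left sum_divide_distrib)
  finally show ?thesis
    by (simp add: K_def)
qed

lemma average_hitting_time_bounds:
  assumes "\<And>w. w \<in> V \<Longrightarrow> h w w = 0"
    and h: "\<And>w v. w \<in> V \<Longrightarrow> v \<in> V \<Longrightarrow> v \<noteq> w \<Longrightarrow> lap (h w) v = wdeg v"
    and a1: "\<And>v w. v \<in> V \<Longrightarrow> w \<in> V \<Longrightarrow> a v w \<le> 1"
    and dmin: "0 < dmin" "\<And>v. v \<in> V \<Longrightarrow> dmin \<le> wdeg v" and v: "v \<in> V"
  shows "real (card V) - 2 \<le> (\<Sum>w\<in>V. wdeg w / total_deg * h w v)"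
    and "(\<Sum>w\<in>V. wdeg w / total_deg * h w v) \<le> real (card V) * (1 + 1 / dmin + 1 / (dmin * gap))"
proof -
  note b = mean_hitting_time[OF _ assms(1) h a1 dmin]
  have D: "0 < total_deg" using total_deg_pos v .
  have "real (card V) - 2 = (\<Sum>w\<in>V. 1 - 2 * (wdeg w / total_deg))"
    using D by (simp add: sum_subtractf sum_distrib_left[symmetric] sum_divide_distrib[symmetric] total_deg_def[symmetric])
  also have "\<dots> \<le> (\<Sum>w\<in>V. wdeg w / total_deg * mean (h w))"
    by (intro sum_mono b(1)) auto
  finally show "real (card V) - 2 \<le> (\<Sum>w\<in>V. wdeg w / total_deg * h w v)"
    using random_target[OF h v] by simp
  have "(\<Sum>w\<in>V. wdeg w / total_deg * mean (h w)) \<le> (\<Sum>w\<in>V. 1 + 1 / dmin + 1 / (dmin * gap))"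
    by (intro sum_mono b(2)) auto
  then show "(\<Sum>w\<in>V. wdeg w / total_deg * h w v) \<le> real (card V) * (1 + 1 / dmin + 1 / (dmin * gap))"
    using random_target[OF h v] by simp
qed

end


section \<open>Cheeger's inequality\<close>

context weighted_graph begin

text \<open>A discrete coarea formula by peeling off layers: subtracting the least value
  \<open>c\<close> of \<open>F\<close> on its support \<open>S\<close> lowers the sum by
  \<open>c\<close> times \<open>card S\<close> and the total variation by \<open>2 * c\<close> times
  the cut of \<open>S\<close>, and it shrinks the support. The 2 appears because each pair is
  counted in both orders.\<close>

lemma coarea_inequality:
  assumes F: "\<And>v. v \<in> V \<Longrightarrow> 0 \<le> F v" and supp: "2 * card {v\<in>V. F v \<noteq> 0} \<le> card V"
    and expand: "\<And>S. S \<subseteq> V \<Longrightarrow> S \<noteq> {} \<Longrightarrow> 2 * card S \<le> card V \<Longrightarrow>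
      h * real (card S) \<le> (\<Sum>v\<in>S. \<Sum>w\<in>V-S. a v w)"
  shows "2 * h * (\<Sum>v\<in>V. F v) \<le> (\<Sum>v\<in>V. \<Sum>w\<in>V. a v w * \<bar>F v - F w\<bar>)"
  using F supp
proof (induction "card {v\<in>V. F v \<noteq> 0}" arbitrary: F rule: less_induct)
  case less
  define S where "S = {v\<in>V. F v \<noteq> 0}"
  have SV: "S \<subseteq> V" and fS: "finite S" by (auto simp: S_def)
  show ?case
  proof (cases "S = {}")
    case True
    then have "F v = 0" if "v \<in> V" for v using that by (auto simp: S_def)
    then show ?thesis by (simp add: sum_nonneg)
  next
    case False
    define c where "c = Min (F ` S)"
    have "c \<in> F ` S" unfolding c_def using fS False by (intro Min_in) auto
    then obtain u where u: "u \<in> S" "F u = c" by auto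
    have c_le: "c \<le> F v" if "v \<in> S" for v
      unfolding c_def using fS that by (intro Min_le) auto
    have c0: "0 < c" using u less.prems(1)[of u] by (force simp: S_def)
    define F' where "F' v = F v - c * of_bool (v \<in> S)" for v
    have F'0: "0 \<le> F' v" if "v \<in> V" for v
      using c_le[of v] less.prems(1)[OF that] by (simp add: F'_def)
    have sub: "{v\<in>V. F' v \<noteq> 0} \<subseteq> S - {u}"
      using u c0 by (auto simp: F'_def S_def)
    then have lt: "card {v\<in>V. F' v \<noteq> 0} < card S"
      using fS u(1) by (metis card_Diff1_less card_mono finite_Diff le_less_trans)
    have "2 * h * (\<Sum>v\<in>V. F' v) \<le> (\<Sum>v\<in>V. \<Sum>w\<in>V. a v w * \<bar>F' v - F' w\<bar>)"
      using lt less.prems(2) F'0 by (intro less.hyps) (auto simp: S_def)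
    moreover have "h * real (card S) \<le> (\<Sum>v\<in>S. \<Sum>w\<in>V-S. a v w)"
      using less.prems(2) SV False by (intro expand) (auto simp: S_def)
    then have "c * (2 * (h * real (card S))) \<le> c * (2 * (\<Sum>v\<in>S. \<Sum>w\<in>V-S. a v w))"
      using c0 by simp
    moreover have "(\<Sum>v\<in>V. F v) = (\<Sum>v\<in>V. F' v) + c * real (card S)"
    proof -
      have "V \<inter> {v. v \<in> S} = S" using SV by auto
      then show ?thesis
        by (simp add: F'_def sum_subtractf sum_distrib_left[symmetric] of_bool_def sum.If_cases)
    qed
    moreover have "(\<Sum>v\<in>V. \<Sum>w\<in>V. a v w * \<bar>F v - F w\<bar>) =
        (\<Sum>v\<in>V. \<Sum>w\<in>V. a v w * \<bar>F' v - F' w\<bar>) + c * (2 * (\<Sum>v\<in>S. \<Sum>w\<in>V-S. a v w))"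
    proof -
      have split: "\<bar>F v - F w\<bar> = \<bar>F' v - F' w\<bar> +
          (c * of_bool (v \<in> S \<and> w \<notin> S) + c * of_bool (w \<in> S \<and> v \<notin> S))"
        if "v \<in> V" "w \<in> V" for v w
        using that c_le[of v] c_le[of w] c0 less.prems(1)[of v] less.prems(1)[of w]
        by (auto simp: F'_def S_def)
      have cut: "(\<Sum>v\<in>V. \<Sum>w\<in>V. a v w * (c * of_bool (v \<in> S \<and> w \<notin> S)))
          = c * (\<Sum>v\<in>S. \<Sum>w\<in>V-S. a v w)"
      proof -
        have "(\<Sum>v\<in>V. \<Sum>w\<in>V. a v w * (c * of_bool (v \<in> S \<and> w \<notin> S)))
            = (\<Sum>v\<in>S. \<Sum>w\<in>V. a v w * (c * of_bool (v \<in> S \<and> w \<notin> S)))"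
          using SV by (intro sum.mono_neutral_right) auto
        also have "\<dots> = (\<Sum>v\<in>S. \<Sum>w\<in>V-S. a v w * (c * of_bool (v \<in> S \<and> w \<notin> S)))"
          by (intro sum.cong refl sum.mono_neutral_right) auto
        finally show ?thesis
          by (simp add: sum_distrib_left mult.commute)
      qed
      have "(\<Sum>v\<in>V. \<Sum>w\<in>V. a v w * \<bar>F v - F w\<bar>) = (\<Sum>v\<in>V. \<Sum>w\<in>V. a v w * \<bar>F' v - F' w\<bar>
          + (a v w * (c * of_bool (v \<in> S \<and> w \<notin> S)) + a v w * (c * of_bool (w \<in> S \<and> v \<notin> S))))"
        by (intro sum.cong refl) (simp only: split distrib_left)
      also have "\<dots> = (\<Sum>v\<in>V. \<Sum>w\<in>V. a v w * \<bar>F' v - F' w\<bar>)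
          + (c * (\<Sum>v\<in>S. \<Sum>w\<in>V-S. a v w) + c * (\<Sum>v\<in>S. \<Sum>w\<in>V-S. a v w))"
        using sum_sym[of "\<lambda>v w. c * of_bool (v \<in> S \<and> w \<notin> S)"] by (simp add: sum.distrib cut)
      finally show ?thesis by simp
    qed
    ultimately show ?thesis by (simp add: algebra_simps)
  qed
qed

text \<open>The coarea inequality is applied to the square of \<open>g\<close>; factoring the
  difference of squares and Young's inequality bring in the energy.\<close>

lemma cheeger_half:
  assumes g: "\<And>v. v \<in> V \<Longrightarrow> 0 \<le> g v" and supp: "2 * card {v\<in>V. g v \<noteq> 0} \<le> card V"
    and expand: "\<And>S. S \<subseteq> V \<Longrightarrow> S \<noteq> {} \<Longrightarrow> 2 * card S \<le> card V \<Longrightarrow>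
      h * real (card S) \<le> (\<Sum>v\<in>S. \<Sum>w\<in>V-S. a v w)"
    and h: "0 < h" and B: "0 < B" "\<And>v. v \<in> V \<Longrightarrow> wdeg v \<le> B"
  shows "h\<^sup>2 / (2 * B) * (\<Sum>v\<in>V. (g v)\<^sup>2) \<le> energy g"
proof -
  \<comment> \<open>Chosen so that the degree term of Young's inequality costs exactly
    \<open>h * ?G\<close>, half of the left-hand side \<open>2 * h * ?G\<close>.\<close>
  define \<tau> where "\<tau> = 2 * B / h"
  have \<tau>: "0 < \<tau>" using h B by (simp add: \<tau>_def)
  let ?G = "\<Sum>v\<in>V. (g v)\<^sup>2"
  have "2 * h * ?G \<le> (\<Sum>v\<in>V. \<Sum>w\<in>V. a v w * \<bar>(g v)\<^sup>2 - (g w)\<^sup>2\<bar>)"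
    using supp expand by (intro coarea_inequality) auto
  also have "\<dots> \<le> (\<Sum>v\<in>V. \<Sum>w\<in>V. \<tau> / 2 * (a v w * (g v - g w)\<^sup>2) + 1 / \<tau> * (a v w * ((g v)\<^sup>2 + (g w)\<^sup>2)))"
  proof (intro sum_mono)
    fix v w assume v: "v \<in> V" and w: "w \<in> V"
    have "\<bar>(g v)\<^sup>2 - (g w)\<^sup>2\<bar> = \<bar>g v - g w\<bar> * (g v + g w)"
      using g[OF v] g[OF w] by (simp add: power2_eq_square square_diff_square_factored abs_mult mult.commute)
    also have "\<dots> \<le> \<tau> / 2 * \<bar>g v - g w\<bar>\<^sup>2 + (g v + g w)\<^sup>2 / (2 * \<tau>)"
    proof -
      have "0 \<le> (\<tau> * \<bar>g v - g w\<bar> - (g v + g w))\<^sup>2 / (2 * \<tau>)" using \<tau> by simp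
      also have "\<dots> = \<tau> / 2 * \<bar>g v - g w\<bar>\<^sup>2 + (g v + g w)\<^sup>2 / (2 * \<tau>) - \<bar>g v - g w\<bar> * (g v + g w)"
        using \<tau> unfolding power2_diff[of "\<tau> * \<bar>g v - g w\<bar>"]
        by (simp add: power_mult_distrib diff_divide_distrib add_divide_distrib) (simp add: field_simps power2_eq_square)
      finally show ?thesis by simp
    qed
    also have "(g v + g w)\<^sup>2 / (2 * \<tau>) \<le> (2 * ((g v)\<^sup>2 + (g w)\<^sup>2)) / (2 * \<tau>)"
      using \<tau> sum_squares_bound[of "g v" "g w"]
      by (intro divide_right_mono) (auto simp: power2_sum)
    finally have "\<bar>(g v)\<^sup>2 - (g w)\<^sup>2\<bar> \<le> \<tau> / 2 * (g v - g w)\<^sup>2 + 1 / \<tau> * ((g v)\<^sup>2 + (g w)\<^sup>2)"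
      using \<tau> by (simp add: field_simps)
    from mult_left_mono[OF this a_nonneg[of v w]]
    show "a v w * \<bar>(g v)\<^sup>2 - (g w)\<^sup>2\<bar> \<le>
        \<tau> / 2 * (a v w * (g v - g w)\<^sup>2) + 1 / \<tau> * (a v w * ((g v)\<^sup>2 + (g w)\<^sup>2))"
      by (simp add: algebra_simps)
  qed
  also have "\<dots> = \<tau> / 2 * (2 * energy g) + 1 / \<tau> * (\<Sum>v\<in>V. \<Sum>w\<in>V. a v w * (g v)\<^sup>2 + a v w * (g w)\<^sup>2)"
    unfolding energy_eq by (simp add: sum.distrib sum_distrib_left distrib_left)
  also have "(\<Sum>v\<in>V. \<Sum>w\<in>V. a v w * (g v)\<^sup>2 + a v w * (g w)\<^sup>2) = 2 * (\<Sum>v\<in>V. wdeg v * (g v)\<^sup>2)"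
    using sum_sym[of "\<lambda>v w. (g v)\<^sup>2"] sum_wdeg_neighbours[of "\<lambda>v. (g v)\<^sup>2"] by (simp add: sum.distrib)
  also have "1 / \<tau> * (2 * (\<Sum>v\<in>V. wdeg v * (g v)\<^sup>2)) \<le> 1 / \<tau> * (2 * (B * ?G))"
    using \<tau> B(2) by (intro mult_left_mono) (auto simp: sum_distrib_left intro!: sum_mono mult_right_mono)
  also have "1 / \<tau> * (2 * (B * ?G)) = h * ?G"
    using B h by (simp add: \<tau>_def)
  finally have "h * ?G \<le> 2 * B / h * energy g"
    by (simp add: \<tau>_def ac_simps)
  then have "h / (2 * B) * (h * ?G) \<le> h / (2 * B) * (2 * B / h * energy g)"
    using h B by (intro mult_left_mono) auto
  then show ?thesis
    using h B by (simp add: power2_eq_square)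
qed

text \<open>The median is the least attained value with at most half of the vertices strictly above
  it. The next smaller attained value violates this, so more than half of the vertices lie at or
  above the median.\<close>

lemma ex_median:
  fixes f :: "'a \<Rightarrow> real"
  assumes "V \<noteq> {}"
  shows "\<exists>m. 2 * card {v\<in>V. m < f v} \<le> card V \<and> 2 * card {v\<in>V. f v < m} \<le> card V"
proof -
  define A where "A = {x \<in> f ` V. 2 * card {v\<in>V. x < f v} \<le> card V}"
  have "Max (f ` V) \<in> f ` V" using assms by (intro Max_in) auto
  have empty: "{v\<in>V. Max (f ` V) < f v} = {}"
    by (auto simp: not_less)
  have "2 * card {v\<in>V. Max (f ` V) < f v} \<le> card V"
    unfolding empty by simp
  with \<open>Max (f ` V) \<in> f ` V\<close> have "Max (f ` V) \<in> A" by (simp only: A_def mem_Collect_eq)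
  then have A: "finite A" "A \<noteq> {}" by (auto simp: A_def)
  define m where "m = Min A"
  have m: "m \<in> A" unfolding m_def using A by (rule Min_in)
  have "2 * card {v\<in>V. f v < m} \<le> card V"
  proof (cases "{v\<in>V. f v < m} = {}")
    case False
    define y where "y = Max (f ` {v\<in>V. f v < m})"
    have "y \<in> f ` {v\<in>V. f v < m}"
      unfolding y_def using False by (intro Max_in) auto
    then have y: "y \<in> f ` V" "y < m" by auto
    then have "y \<notin> A" using A m_def by (metis Min_le not_less)
    then have "card V < 2 * card {v\<in>V. y < f v}"
      using y by (auto simp: A_def)
    moreover have "{v\<in>V. y < f v} \<subseteq> V - {v\<in>V. f v < m}"
    proof
      fix v assume v: "v \<in> {v\<in>V. y < f v}"
      have "f v \<le> y" if "f v < m"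
        using v that unfolding y_def by (intro Max_ge) auto
      then show "v \<in> V - {v\<in>V. f v < m}" using v by force
    qed
    then have "card {v\<in>V. y < f v} \<le> card V - card {v\<in>V. f v < m}"
      using card_mono[of "V - {v\<in>V. f v < m}"] by (simp add: card_Diff_subset)
    ultimately show ?thesis by linarith
  qed (metis card.empty mult_0_right zero_le)
  then show ?thesis using m by (auto simp: A_def)
qed

text \<open>\<open>c\<close> is a median of \<open>f\<close>: both parts of \<open>f - c\<close>
  then live on at most half of the vertices, where expansion is available.\<close>

lemma cheeger:
  assumes expand: "\<And>S. S \<subseteq> V \<Longrightarrow> S \<noteq> {} \<Longrightarrow> 2 * card S \<le> card V \<Longrightarrow>
      h * real (card S) \<le> (\<Sum>v\<in>S. \<Sum>w\<in>V-S. a v w)"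
    and h: "0 < h" and B: "0 < B" "\<And>v. v \<in> V \<Longrightarrow> wdeg v \<le> B"
  shows "\<exists>c. h\<^sup>2 / (2 * B) * (\<Sum>v\<in>V. (f v - c)\<^sup>2) \<le> energy f"
proof (cases "V = {}")
  case False
  then obtain m where m: "2 * card {v\<in>V. m < f v} \<le> card V" "2 * card {v\<in>V. f v < m} \<le> card V"
    using ex_median by blast
  define g1 g2 where "g1 v = max 0 (f v - m)" and "g2 v = max 0 (m - f v)" for v
  have "{v\<in>V. g1 v \<noteq> 0} = {v\<in>V. m < f v}" "{v\<in>V. g2 v \<noteq> 0} = {v\<in>V. f v < m}"
    by (auto simp: g1_def g2_def max_def)
  then have "h\<^sup>2 / (2 * B) * (\<Sum>v\<in>V. (g1 v)\<^sup>2) \<le> energy g1"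
    and "h\<^sup>2 / (2 * B) * (\<Sum>v\<in>V. (g2 v)\<^sup>2) \<le> energy g2"
    using m expand h B by (intro cheeger_half; simp add: g1_def g2_def)+
  moreover have "(\<Sum>v\<in>V. (f v - m)\<^sup>2) = (\<Sum>v\<in>V. (g1 v)\<^sup>2) + (\<Sum>v\<in>V. (g2 v)\<^sup>2)"
    unfolding sum.distrib[symmetric]
    by (intro sum.cong) (auto simp: g1_def g2_def max_def power2_commute)
  moreover have "energy g1 + energy g2 \<le> energy f"
  proof -
    have sq: "(g1 v - g1 w)\<^sup>2 + (g2 v - g2 w)\<^sup>2 \<le> (f v - f w)\<^sup>2" for v w
    proof -
      \<comment> \<open>The increments of the positive part and of the negated negative part have
        the same sign, so the cross term helps.\<close>
      have "0 \<le> (g1 v - g1 w) * (g2 w - g2 v)"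
        by (cases "f v \<le> f w") (auto simp: g1_def g2_def max_def mult_nonpos_nonpos)
      moreover have "f v - f w = (g1 v - g1 w) + (g2 w - g2 v)"
        by (auto simp: g1_def g2_def)
      ultimately show ?thesis
        by (simp add: power2_sum power2_commute[of "g2 w"] mult.assoc del: right_diff_distrib_numeral)
    qed
    have "2 * (energy g1 + energy g2) = (\<Sum>v\<in>V. \<Sum>w\<in>V. a v w * ((g1 v - g1 w)\<^sup>2 + (g2 v - g2 w)\<^sup>2))"
      by (simp add: distrib_left energy_eq sum.distrib)
    also have "\<dots> \<le> 2 * energy f"
      unfolding energy_eq by (intro sum_mono mult_left_mono sq) auto
    finally show ?thesis by simp
  qed
  ultimately have "h\<^sup>2 / (2 * B) * (\<Sum>v\<in>V. (f v - m)\<^sup>2) \<le> energy f"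
    by (simp add: distrib_left)
  then show ?thesis ..
qed (use energy_nonneg[of f] in simp)

end

text \<open>Expansion and the bound \<open>B\<close> concern the smaller graph \<open>a'\<close>,
  while the measure consists of the degrees of \<open>a\<close>. The transfer uses that the energy
  is monotone in the weights, that degrees are at most \<open>dmax\<close>, and that the mean
  minimizes the second moment, so the constant from Cheeger's inequality may be any number.\<close>

lemma poincare_graphI:
  assumes G: "weighted_graph V a" and G': "weighted_graph V a'"
    and le: "\<And>v w. v \<in> V \<Longrightarrow> w \<in> V \<Longrightarrow> a' v w \<le> a v w"
    and expand: "\<And>S. S \<subseteq> V \<Longrightarrow> S \<noteq> {} \<Longrightarrow> 2 * card S \<le> card V \<Longrightarrow>
      h * real (card S) \<le> (\<Sum>v\<in>S. \<Sum>w\<in>V-S. a' v w)"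
    and h: "0 < h" and B: "0 < B" "\<And>v. v \<in> V \<Longrightarrow> weighted_graph.wdeg V a' v \<le> B"
    and dmax: "0 < dmax" "\<And>v. v \<in> V \<Longrightarrow> weighted_graph.wdeg V a v \<le> dmax"
    and pos: "\<And>v. v \<in> V \<Longrightarrow> 0 < weighted_graph.wdeg V a v"
  shows "poincare_graph V a (h\<^sup>2 / (2 * B) / dmax)"
proof -
  interpret weighted_graph V a by (rule G)
  interpret G': weighted_graph V a' by (rule G')
  show ?thesis
  proof
    show "0 < h\<^sup>2 / (2 * B) / dmax" using h B dmax by simp
  next
    fix f :: "'a \<Rightarrow> real"
    assume f0: "(\<Sum>v\<in>V. wdeg v * f v) = 0"
    have "\<exists>c. h\<^sup>2 / (2 * B) * (\<Sum>v\<in>V. (f v - c)\<^sup>2) \<le> G'.energy f"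
      by (rule G'.cheeger[OF expand h B])
    then obtain c where c: "h\<^sup>2 / (2 * B) * (\<Sum>v\<in>V. (f v - c)\<^sup>2) \<le> G'.energy f" ..
    have "(\<Sum>v\<in>V. wdeg v * (f v)\<^sup>2)
        \<le> (\<Sum>v\<in>V. wdeg v * (f v)\<^sup>2 - 2 * c * (wdeg v * f v) + c\<^sup>2 * wdeg v)"
      using sum_nonneg[of V wdeg] wdeg_nonneg
      by (simp add: sum.distrib sum_subtractf f0 flip: sum_distrib_left)
    also have "\<dots> = (\<Sum>v\<in>V. wdeg v * (f v - c)\<^sup>2)"
      by (intro sum.cong) (auto simp: power2_eq_square algebra_simps)
    also have "\<dots> \<le> dmax * (\<Sum>v\<in>V. (f v - c)\<^sup>2)"
      unfolding sum_distrib_left by (intro sum_mono mult_right_mono dmax(2)) auto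
    finally have "h\<^sup>2 / (2 * B) / dmax * (\<Sum>v\<in>V. wdeg v * (f v)\<^sup>2)
        \<le> h\<^sup>2 / (2 * B) / dmax * (dmax * (\<Sum>v\<in>V. (f v - c)\<^sup>2))"
      using B dmax by (intro mult_left_mono) auto
    also have "\<dots> = h\<^sup>2 / (2 * B) * (\<Sum>v\<in>V. (f v - c)\<^sup>2)"
      using dmax by simp
    also have "\<dots> \<le> G'.energy f" by (rule c)
    also have "G'.energy f \<le> energy f"
    proof -
      have "2 * G'.energy f \<le> 2 * energy f"
        unfolding energy_eq G'.energy_eq by (intro sum_mono mult_right_mono le) auto
      then show ?thesis by simp
    qed
    finally show "h\<^sup>2 / (2 * B) / dmax * (\<Sum>v\<in>V. wdeg v * (f v)\<^sup>2) \<le> energy f" .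
  qed (rule pos)
qed


section \<open>Chernoff bounds\<close>

lemma finite_set_Pi_bernoulli: "finite A \<Longrightarrow> finite (set_pmf (Pi_pmf A False (\<lambda>e. bernoulli_pmf (\<pi> e))))"
  by (rule finite_subset[OF set_Pi_pmf_subset'])  auto

lemma expectation_exp_sum_bernoulli:
  fixes \<pi> :: "'a \<Rightarrow> real" and t :: real
  assumes fin: "finite A" and F: "F \<subseteq> A" and \<pi>: "\<And>e. e \<in> A \<Longrightarrow> \<pi> e \<in> {0..1}"
  shows "measure_pmf.expectation (Pi_pmf A False (\<lambda>e. bernoulli_pmf (\<pi> e)))
      (\<lambda>\<epsilon>. exp (t * (\<Sum>e\<in>F. of_bool (\<epsilon> e)))) \<le> exp ((exp t - 1) * (\<Sum>e\<in>F. \<pi> e))"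
proof -
  let ?P = "Pi_pmf A False (\<lambda>e. bernoulli_pmf (\<pi> e))"
  \<comment> \<open>Constant 1 for \<open>e\<close> outside \<open>F\<close>, so that the product
    can run over all of \<open>A\<close>, as independence is stated there.\<close>
  define g where "g e x = exp (t * of_bool (e \<in> F \<and> x))" for e x
  have fF: "finite F" using fin F by (rule finite_subset[rotated])
  have eq: "exp (t * (\<Sum>e\<in>F. of_bool (\<epsilon> e))) = (\<Prod>e\<in>A. g e (\<epsilon> e))" for \<epsilon>
  proof -
    have "(\<Prod>e\<in>A. g e (\<epsilon> e)) = (\<Prod>e\<in>F. g e (\<epsilon> e))"
      using fin F by (intro prod.mono_neutral_right) (auto simp: g_def)
    also have "\<dots> = (\<Prod>e\<in>F. exp (t * of_bool (\<epsilon> e)))"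
      by (intro prod.cong) (auto simp: g_def)
    also have "\<dots> = exp (t * (\<Sum>e\<in>F. of_bool (\<epsilon> e)))"
      unfolding sum_distrib_left using fF by (rule exp_sum[symmetric])
    finally show ?thesis by simp
  qed
  have "measure_pmf.expectation ?P (\<lambda>\<epsilon>. \<Prod>e\<in>A. g e (\<epsilon> e))
      = (\<Prod>e\<in>A. measure_pmf.expectation (bernoulli_pmf (\<pi> e)) (g e))"
    using fin by (intro expectation_prod_Pi_pmf integrable_measure_pmf_finite) (auto simp: g_def)
  also have "\<dots> \<le> (\<Prod>e\<in>A. exp ((exp t - 1) * (if e \<in> F then \<pi> e else 0)))"
  proof (rule prod_mono, safe)
    fix e assume e: "e \<in> A"
    have "measure_pmf.expectation (bernoulli_pmf (\<pi> e)) (g e) = 1 + (exp t - 1) * (if e \<in> F then \<pi> e else 0)"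
      using \<pi>[OF e] by (simp add: g_def algebra_simps)
    also have "\<dots> \<le> exp ((exp t - 1) * (if e \<in> F then \<pi> e else 0))"
      by (rule exp_ge_add_one_self)
    finally show "measure_pmf.expectation (bernoulli_pmf (\<pi> e)) (g e) \<le> exp ((exp t - 1) * (if e \<in> F then \<pi> e else 0))" .
    show "0 \<le> measure_pmf.expectation (bernoulli_pmf (\<pi> e)) (g e)"
      by (intro integral_nonneg_AE) (simp add: g_def)
  qed
  also have "\<dots> = exp ((exp t - 1) * (\<Sum>e\<in>F. \<pi> e))"
    using fin F by (simp add: exp_sum[symmetric] sum_distrib_left[symmetric] sum.If_cases Int_absorb1)
  finally show ?thesis
    by (simp add: eq)
qed

text \<open>\<open>t\<close> stays inside the event and may have either sign: -1 yields the lower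
  tail and 1 the upper one.\<close>

lemma chernoff_bernoulli:
  fixes \<pi> :: "'a \<Rightarrow> real" and t c :: real
  assumes fin: "finite A" and F: "F \<subseteq> A" and \<pi>: "\<And>e. e \<in> A \<Longrightarrow> \<pi> e \<in> {0..1}"
  shows "measure_pmf.prob (Pi_pmf A False (\<lambda>e. bernoulli_pmf (\<pi> e)))
      {\<epsilon>. c \<le> t * (\<Sum>e\<in>F. of_bool (\<epsilon> e))} \<le> exp ((exp t - 1) * (\<Sum>e\<in>F. \<pi> e) - c)"
proof -
  let ?P = "Pi_pmf A False (\<lambda>e. bernoulli_pmf (\<pi> e))"
  let ?Y = "\<lambda>\<epsilon>. exp (t * (\<Sum>e\<in>F. of_bool (\<epsilon> e)))"
  have "measure_pmf.prob ?P {\<epsilon> \<in> space ?P. exp c \<le> ?Y \<epsilon>} \<le> measure_pmf.expectation ?P ?Y / exp c"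
    by (intro integral_Markov_inequality_measure[where A = "{}"]
        integrable_measure_pmf_finite finite_set_Pi_bernoulli fin) auto
  also have "\<dots> \<le> exp ((exp t - 1) * (\<Sum>e\<in>F. \<pi> e)) / exp c"
    by (intro divide_right_mono expectation_exp_sum_bernoulli[OF fin F \<pi>]) auto
  finally show ?thesis
    by (simp add: exp_diff)
qed

text \<open>With \<open>t = -1\<close> and \<open>exp (-1) - 1 \<le> -1/2\<close> the exponent is at
  most -\<mu>/2 + \<mu>/4. Here \<mu> need only bound the mean from below, which covers degrees of
  blocks with different means.\<close>

lemma chernoff_bernoulli_lower:
  fixes \<pi> :: "'a \<Rightarrow> real"
  assumes "finite A" and "F \<subseteq> A" and \<pi>: "\<And>e. e \<in> A \<Longrightarrow> \<pi> e \<in> {0..1}"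
    and \<mu>: "0 \<le> \<mu>" "\<mu> \<le> (\<Sum>e\<in>F. \<pi> e)"
  shows "measure_pmf.prob (Pi_pmf A False (\<lambda>e. bernoulli_pmf (\<pi> e)))
      {\<epsilon>. (\<Sum>e\<in>F. of_bool (\<epsilon> e)) \<le> \<mu> / 4} \<le> exp (- \<mu> / 4)"
proof -
  have "exp (-1) \<le> (1 / 2 :: real)"
    using exp_ge_add_one_self[of "1::real"] by (simp add: exp_minus field_simps)
  then have "(exp (-1) - 1) * (\<Sum>e\<in>F. \<pi> e) \<le> - (1/2) * (\<Sum>e\<in>F. \<pi> e)"
    using \<mu> by (intro mult_right_mono) auto
  also have "\<dots> \<le> - (1/2) * \<mu>"
    using \<mu> by simp
  finally have "(exp (-1) - 1) * (\<Sum>e\<in>F. \<pi> e) - - (\<mu> / 4) \<le> - \<mu> / 4"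
    by simp
  then have "exp ((exp (-1) - 1) * (\<Sum>e\<in>F. \<pi> e) - - (\<mu> / 4)) \<le> exp (- \<mu> / 4)"
    by simp
  moreover have "{\<epsilon>. (\<Sum>e\<in>F. of_bool (\<epsilon> e)) \<le> \<mu> / 4} = {\<epsilon>. - (\<mu> / 4) \<le> -1 * (\<Sum>e\<in>F. of_bool (\<epsilon> e))}"
    by auto
  ultimately show ?thesis
    by (simp only:) (rule order_trans[OF chernoff_bernoulli[where \<pi> = \<pi>, OF assms(1-3)]])
qed

lemma chernoff_bernoulli_upper:
  fixes \<pi> :: "'a \<Rightarrow> real"
  assumes "finite A" and "F \<subseteq> A" and \<pi>: "\<And>e. e \<in> A \<Longrightarrow> \<pi> e \<in> {0..1}"
    and \<mu>: "(\<Sum>e\<in>F. \<pi> e) \<le> \<mu>"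
  shows "measure_pmf.prob (Pi_pmf A False (\<lambda>e. bernoulli_pmf (\<pi> e)))
      {\<epsilon>. 4 * \<mu> \<le> (\<Sum>e\<in>F. of_bool (\<epsilon> e))} \<le> exp (- \<mu>)"
proof -
  have "0 \<le> (\<Sum>e\<in>F. \<pi> e)"
    using assms(2) \<pi> by (intro sum_nonneg) force
  then have "(exp 1 - 1) * (\<Sum>e\<in>F. \<pi> e) \<le> 2 * \<mu>"
    using \<mu> exp_le by (intro mult_mono) auto
  then have "exp ((exp 1 - 1) * (\<Sum>e\<in>F. \<pi> e) - 4 * \<mu>) \<le> exp (- \<mu>)"
    using \<mu> \<open>0 \<le> (\<Sum>e\<in>F. \<pi> e)\<close> by simp
  moreover have "{\<epsilon>. 4 * \<mu> \<le> (\<Sum>e\<in>F. of_bool (\<epsilon> e))} = {\<epsilon>. 4 * \<mu> \<le> 1 * (\<Sum>e\<in>F. of_bool (\<epsilon> e))}"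
    by simp
  ultimately show ?thesis
    by (simp only:) (rule order_trans[OF chernoff_bernoulli[where \<pi> = \<pi>, OF assms(1-3)]])
qed


section \<open>Expected hitting times\<close>

text \<open>The probability that the chain started in \<open>v\<close> is in \<open>A\<close> at all
  times 0, ..., n. The recursion over the first step is built in, because it produces the linear
  system for hitting times.\<close>

primrec stay_prob :: "(nat \<Rightarrow> nat pmf) \<Rightarrow> nat set \<Rightarrow> nat \<Rightarrow> nat \<Rightarrow> real" where
  "stay_prob K A 0 v = of_bool (v \<in> A)"
| "stay_prob K A (Suc n) v = of_bool (v \<in> A) * (\<Sum>u\<in>A. pmf (K v) u * stay_prob K A n u)"

lemma stay_prob_nonneg: "0 \<le> stay_prob K A n v"
  by (induction n arbitrary: v) (auto intro!: sum_nonneg)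

text \<open>The cylinder probability of \<open>chain_measure\<close>, indexed by lists of length
  \<open>n + 1\<close> so that the paths inside a finite set form a finite set. It links
  trajectories to \<open>stay_prob\<close> without a Markov property on path space.\<close>

definition path_weight :: "(nat \<Rightarrow> nat pmf) \<Rightarrow> nat \<Rightarrow> nat \<Rightarrow> nat list \<Rightarrow> real" where
  "path_weight K v n xs = of_bool (xs ! 0 = v) * (\<Prod>i<n. pmf (K (xs ! i)) (xs ! Suc i))"

lemma sum_path_weight:
  assumes "finite A"
  shows "(\<Sum>xs | set xs \<subseteq> A \<and> length xs = Suc n. path_weight K v n xs) = stay_prob K A n v"
proof (induction n arbitrary: v)
  case 0
  have "{xs. set xs \<subseteq> A \<and> length xs = Suc 0} = (\<lambda>x. [x]) ` A"
    by (auto simp: length_Suc_conv)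
  then have "(\<Sum>xs | set xs \<subseteq> A \<and> length xs = Suc 0. path_weight K v 0 xs) = (\<Sum>x\<in>A. of_bool (x = v))"
    by (simp add: sum.reindex inj_on_def path_weight_def del: sum_of_bool_eq)
  then show ?case
    using assms by (simp add: of_bool_def if_distrib sum.delta cong: if_cong)
next
  case (Suc n)
  let ?L = "{xs. set xs \<subseteq> A \<and> length xs = Suc n}"
  have "{xs. set xs \<subseteq> A \<and> length xs = Suc (Suc n)} = (\<lambda>(x, xs). x # xs) ` (A \<times> ?L)"
    by (auto simp: image_iff length_Suc_conv)
  then have "(\<Sum>xs | set xs \<subseteq> A \<and> length xs = Suc (Suc n). path_weight K v (Suc n) xs)
      = (\<Sum>z\<in>A \<times> ?L. path_weight K v (Suc n) (fst z # snd z))"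
    by (subst sum.reindex[symmetric, unfolded o_def]) (auto simp: inj_on_def case_prod_beta)
  also have "\<dots> = (\<Sum>x\<in>A. \<Sum>xs\<in>?L. path_weight K v (Suc n) (x # xs))"
    by (simp add: sum.cartesian_product case_prod_beta)
  also have "\<dots> = (\<Sum>x\<in>A. \<Sum>xs\<in>?L. of_bool (x = v) * (\<Sum>u\<in>A. pmf (K x) u * path_weight K u n xs))"
  proof (intro sum.cong refl)
    fix x xs assume xs: "xs \<in> ?L"
    then have "xs ! 0 \<in> A" by (auto intro!: subsetD[of "set xs" A])
    moreover have "(\<Sum>u\<in>A. pmf (K x) u * path_weight K u n xs)
        = (\<Sum>u\<in>A. if u = xs ! 0 then pmf (K x) (xs ! 0) * (\<Prod>i<n. pmf (K (xs ! i)) (xs ! Suc i)) else 0)"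
      by (intro sum.cong) (auto simp: path_weight_def)
    ultimately have "(\<Sum>u\<in>A. pmf (K x) u * path_weight K u n xs)
        = pmf (K x) (xs ! 0) * (\<Prod>i<n. pmf (K (xs ! i)) (xs ! Suc i))"
      using assms by simp
    then show "path_weight K v (Suc n) (x # xs)
        = of_bool (x = v) * (\<Sum>u\<in>A. pmf (K x) u * path_weight K u n xs)"
      by (simp add: path_weight_def prod.lessThan_Suc_shift del: prod.lessThan_Suc)
  qed
  also have "\<dots> = (\<Sum>x\<in>A. of_bool (x = v) * (\<Sum>u\<in>A. pmf (K x) u * stay_prob K A n u))"
  proof (intro sum.cong refl)
    fix x
    have "(\<Sum>xs\<in>?L. \<Sum>u\<in>A. pmf (K x) u * path_weight K u n xs)
        = (\<Sum>u\<in>A. pmf (K x) u * stay_prob K A n u)"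
      by (subst sum.swap) (simp add: sum_distrib_left[symmetric] Suc)
    then show "(\<Sum>xs\<in>?L. of_bool (x = v) * (\<Sum>u\<in>A. pmf (K x) u * path_weight K u n xs))
        = of_bool (x = v) * (\<Sum>u\<in>A. pmf (K x) u * stay_prob K A n u)"
      by (simp add: sum_distrib_left[symmetric])
  qed
  also have "\<dots> = stay_prob K A (Suc n) v"
    using assms by (simp add: of_bool_def if_distrib[of "\<lambda>x. x * _"] sum.delta cong: if_cong)
  finally show ?case .
qed

lemma sets_chain_all_le: "{X. \<forall>i\<le>n. X i \<in> B i} \<in> sets (chain_measure K v)"
proof -
  let ?M = "PiM UNIV (\<lambda>_::nat. count_space (UNIV :: nat set))"
  have "{X \<in> space ?M. \<forall>i\<in>{..n}. X i \<in> B i} \<in> sets ?M"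
  proof (rule sets.sets_Collect_finite_All)
    fix i
    have "(\<lambda>X. X i) -` B i \<inter> space ?M \<in> sets ?M"
      by (rule measurable_sets[OF measurable_component_singleton]) auto
    also have "(\<lambda>X. X i) -` B i \<inter> space ?M = {X \<in> space ?M. X i \<in> B i}" by auto
    finally show "{X \<in> space ?M. X i \<in> B i} \<in> sets ?M" .
  qed simp
  then show ?thesis
    by (simp add: sets_chain_measure space_PiM Ball_def)
qed

lemma emeasure_chain_stay:
  assumes "finite A"
  shows "emeasure (chain_measure K v) {X. \<forall>i\<le>n. X i \<in> A} = ennreal (stay_prob K A n v)"
proof -
  let ?L = "{xs. set xs \<subseteq> A \<and> length xs = Suc n}"
  let ?C = "\<lambda>xs. {X. \<forall>i\<le>n. X i = xs ! i}"
  have fin: "finite ?L" using assms by (rule finite_lists_length_eq)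
  have "{X. \<forall>i\<le>n. X i \<in> A} = (\<Union>xs\<in>?L. ?C xs)"
  proof safe
    fix X :: "nat \<Rightarrow> nat" assume "\<forall>i\<le>n. X i \<in> A"
    then show "X \<in> (\<Union>xs\<in>?L. ?C xs)"
      by (intro UN_I[of "map X [0..<Suc n]"]) (auto simp del: upt_Suc simp: nth_append)
  next
    fix X :: "nat \<Rightarrow> nat" and xs i
    assume "set xs \<subseteq> A" "length xs = Suc n" "\<forall>i\<le>n. X i = xs ! i" "i \<le> n"
    then show "X i \<in> A" by (metis le_imp_less_Suc nth_mem subsetD)
  qed
  then have "emeasure (chain_measure K v) {X. \<forall>i\<le>n. X i \<in> A}
      = emeasure (chain_measure K v) (\<Union>xs\<in>?L. ?C xs)"
    by simp
  also have "\<dots> = (\<Sum>xs\<in>?L. emeasure (chain_measure K v) (?C xs))"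
  proof (rule sum_emeasure[symmetric])
    show "?C ` ?L \<subseteq> sets (chain_measure K v)"
      using sets_chain_all_le[of n "\<lambda>i. {xs ! i}" for xs] by auto
    show "disjoint_family_on ?C ?L"
    proof (unfold disjoint_family_on_def, safe)
      fix xs ys :: "nat list" and X
      assume l: "length xs = Suc n" "length ys = Suc n" and "xs \<noteq> ys"
        and *: "\<forall>i\<le>n. X i = xs ! i" "\<forall>i\<le>n. X i = ys ! i"
      have "xs = ys" using l * by (intro nth_equalityI) (auto simp: less_Suc_eq_le)
      with \<open>xs \<noteq> ys\<close> show "X \<in> {}" by simp
    qed
  qed (rule fin)
  also have "\<dots> = (\<Sum>xs\<in>?L. ennreal (path_weight K v n xs))"
    by (simp add: emeasure_chain_measure_cylinder path_weight_def)
  also have "\<dots> = ennreal (\<Sum>xs\<in>?L. path_weight K v n xs)"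
    by (intro sum_ennreal) (simp add: path_weight_def prod_nonneg)
  finally show ?thesis
    by (simp add: sum_path_weight[OF assms])
qed

text \<open>The tail sum T = \<Sum> 1{T > n}, valid also for infinite T.\<close>

lemma hitting_time_eq_suminf:
  "hitting_time w X = (\<Sum>n. indicator {X. \<forall>i\<le>n. X i \<in> - {w}} X)"
proof (cases "\<exists>n. X n = w")
  case True
  define k where "k = (LEAST n. X n = w)"
  have k: "X k = w" "\<And>i. i < k \<Longrightarrow> X i \<noteq> w"
    using True unfolding k_def by (auto intro: LeastI dest: not_less_Least)
  have "(\<Sum>n. indicator {X. \<forall>i\<le>n. X i \<in> - {w}} X) = (\<Sum>n<k. 1 :: ennreal)"
  proof -
    have "(\<Sum>n. indicator {X. \<forall>i\<le>n. X i \<in> - {w}} X :: ennreal)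
        = (\<Sum>n<k. indicator {X. \<forall>i\<le>n. X i \<in> - {w}} X)"
      using k(1) by (intro suminf_finite) (auto simp: indicator_def not_less)
    also have "\<dots> = (\<Sum>n<k. 1)"
      using k(2) by (intro sum.cong refl) (auto simp: indicator_def)
    finally show ?thesis .
  qed
  then show ?thesis
    using hitting_time_eq_Least[of X k w, OF k(1)] by (simp add: k_def)
next
  case False
  then have "(\<Sum>n. indicator {X. \<forall>i\<le>n. X i \<in> - {w}} X) = (\<Sum>n. 1 :: ennreal)"
    by (intro suminf_cong) (auto simp: indicator_def)
  also have "\<dots> = \<infinity>"
    by (simp add: suminf_eq_SUP ennreal_SUP_of_nat_eq_top)
  finally show ?thesis
    using False by (simp add: hitting_time_eq_top)
qed

text \<open>The complement of \<open>{w}\<close> is infinite, whereas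
  \<open>emeasure_chain_stay\<close> wants a finite set. Trajectories leaving \<open>V\<close> form
  a null set by \<open>stay\<close>, so the complement may be replaced by
  \<open>V - {w}\<close>.\<close>

lemma expected_hitting_time_eq_suminf:
  assumes V: "finite V" and stay: "\<And>n. stay_prob K V n v = 1"
  shows "(\<integral>\<^sup>+ X. hitting_time w X \<partial>chain_measure K v) = (\<Sum>n. ennreal (stay_prob K (V - {w}) n v))"
proof -
  interpret prob_space "chain_measure K v" by (rule prob_space_chain_measure)
  have "(\<integral>\<^sup>+ X. hitting_time w X \<partial>chain_measure K v)
      = (\<Sum>n. \<integral>\<^sup>+ X. indicator {X. \<forall>i\<le>n. X i \<in> - {w}} X \<partial>chain_measure K v)"
    unfolding hitting_time_eq_suminf by (intro nn_integral_suminf borel_measurable_indicator sets_chain_all_le)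
  also have "\<dots> = (\<Sum>n. emeasure (chain_measure K v) {X. \<forall>i\<le>n. X i \<in> - {w}})"
    by (simp only: nn_integral_indicator[OF sets_chain_all_le])
  also have "\<dots> = (\<Sum>n. emeasure (chain_measure K v) {X. \<forall>i\<le>n. X i \<in> V - {w}})"
  proof (intro suminf_cong emeasure_eq_AE)
    fix n
    have "emeasure (chain_measure K v) {X. \<forall>i\<le>n. X i \<in> V} = 1"
      using emeasure_chain_stay[OF V, of K v n] stay by simp
    then have "prob {X. \<forall>i\<le>n. X i \<in> V} = 1"
      by (simp add: measure_def)
    then have "AE X in chain_measure K v. X \<in> {X. \<forall>i\<le>n. X i \<in> V}"
      by (subst AE_in_set_eq_1) (auto simp: sets_chain_all_le)
    then show "AE X in chain_measure K v.
        (X \<in> {X. \<forall>i\<le>n. X i \<in> - {w}}) = (X \<in> {X. \<forall>i\<le>n. X i \<in> V - {w}})"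
      by eventually_elim auto
  qed (rule sets_chain_all_le)+
  finally show ?thesis
    using V by (simp only: emeasure_chain_stay finite_Diff)
qed


text \<open>Packs the value of the integral and the linear system into one real function, after
  which trajectories are no longer needed.\<close>

lemma ex_hitting_time_solution:
  fixes V :: "nat set"
  assumes pg: "poincare_graph V a gap" and w: "w \<in> V"
    and K: "\<And>v u. v \<in> V \<Longrightarrow> u \<in> V \<Longrightarrow> pmf (K v) u = a v u / weighted_graph.wdeg V a v"
  shows "\<exists>h. h w = 0 \<and> (\<forall>v\<in>V. 0 \<le> h v
      \<and> (\<integral>\<^sup>+ X. hitting_time w X \<partial>chain_measure K v) = ennreal (h v)
      \<and> (v \<noteq> w \<longrightarrow> weighted_graph.lap V a h v = weighted_graph.wdeg V a v))"
proof -
  interpret poincare_graph V a gap by (rule pg)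
  define t where "t = stay_prob K (V - {w})"
  have stay: "stay_prob K V n v = 1" if "v \<in> V" for n v
    using that
  proof (induction n arbitrary: v)
    case (Suc n)
    have "(\<Sum>u\<in>V. pmf (K v) u) = 1"
      using Suc.prems wdeg_pos[of v] by (simp add: K sum_divide_distrib[symmetric]) (simp add: wdeg_def)
    then show ?case using Suc by simp
  qed simp
  have t_nonneg: "0 \<le> t n v" for n v
    by (simp add: t_def stay_prob_nonneg)
  have tw: "t n w = 0" for n
    by (cases n) (auto simp: t_def)
  have t_Suc: "t (Suc n) v = (\<Sum>u\<in>V. a v u * t n u) / wdeg v" if "v \<in> V" "v \<noteq> w" for n v
  proof -
    have "t (Suc n) v = (\<Sum>u\<in>V-{w}. a v u / wdeg v * t n u)"
      using that by (simp add: t_def K)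
    also have "\<dots> = (\<Sum>u\<in>V. a v u / wdeg v * t n u)"
      using tw by (intro sum.mono_neutral_left) auto
    finally show ?thesis by (simp add: sum_divide_distrib)
  qed
  have summable: "summable (\<lambda>n. t n v)" if v: "v \<in> V" for v
  proof (rule summableI_nonneg_bounded)
    fix n
    \<comment> \<open>With T the hitting time of \<open>w\<close>, this is the expectation of min(T,
      n). It vanishes at \<open>w\<close> and is a subsolution, so its bound does not depend on
      \<open>n\<close>.\<close>
    define s where "s u = (\<Sum>k<n. t k u)" for u
    have "lap s u \<le> wdeg u" if u: "u \<in> V" "u \<noteq> w" for u
    proof -
      \<comment> \<open>One extra term is added so that, after the term 1 for time 0 is split off,
        exactly \<open>n\<close> shifted terms remain.\<close>
      have "s u \<le> (\<Sum>k<Suc n. t k u)"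
        by (simp add: s_def t_nonneg)
      also have "\<dots> = 1 + (\<Sum>k<n. t (Suc k) u)"
        using u by (subst sum.lessThan_Suc_shift) (simp add: t_def)
      also have "(\<Sum>k<n. t (Suc k) u) = (\<Sum>y\<in>V. a u y * s y) / wdeg u"
        using u by (simp add: t_Suc s_def sum_distrib_left sum_divide_distrib) (subst sum.swap, rule refl)
      finally have "wdeg u * s u \<le> wdeg u * (1 + (\<Sum>y\<in>V. a u y * s y) / wdeg u)"
        by (intro mult_left_mono wdeg_nonneg)
      also have "\<dots> = wdeg u + (\<Sum>y\<in>V. a u y * s y)"
        using wdeg_pos[OF u(1)] by (simp add: distrib_left)
      finally show ?thesis by (simp add: lap_eq)
    qed
    then show "(\<Sum>k<n. t k v) \<le> total_deg * (total_deg / (gap * wdeg w)) / wdeg v"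
      using subsolution_bounded[OF w, of s v] v by (simp add: s_def tw sum_nonneg t_nonneg)
  qed (rule t_nonneg)
  define h where "h v = (\<Sum>n. t n v)" for v
  have sums: "(\<lambda>n. t n v) sums h v" if "v \<in> V" for v
    unfolding h_def using summable[OF that] by (rule summable_sums)
  have "lap h v = wdeg v" if v: "v \<in> V" "v \<noteq> w" for v
  proof -
    have "(\<lambda>n. (\<Sum>u\<in>V. a v u * t n u) / wdeg v) sums ((\<Sum>u\<in>V. a v u * h u) / wdeg v)"
      by (intro sums_divide sums_sum sums_mult sums)
    then have "(\<lambda>n. t (Suc n) v) sums ((\<Sum>u\<in>V. a v u * h u) / wdeg v)"
      using v by (simp add: t_Suc)
    from sums_Suc[OF this] have "(\<lambda>n. t n v) sums ((\<Sum>u\<in>V. a v u * h u) / wdeg v + 1)"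
      using v by (simp add: t_def)
    then have "h v = (\<Sum>u\<in>V. a v u * h u) / wdeg v + 1"
      using sums[OF v(1)] by (rule sums_unique2[symmetric])
    then show ?thesis
      using wdeg_pos[OF v(1)] by (simp add: lap_eq field_simps)
  qed
  moreover have "(\<integral>\<^sup>+ X. hitting_time w X \<partial>chain_measure K v) = ennreal (h v)" if v: "v \<in> V" for v
    using expected_hitting_time_eq_suminf[of V K v w] stay[OF v] summable[OF v]
    by (simp add: t_def[symmetric] h_def suminf_ennreal2 t_nonneg)
  moreover have "h w = 0"
    by (simp add: h_def tw)
  moreover have "0 \<le> h v" if "v \<in> V" for v
    unfolding h_def using summable[OF that] by (intro suminf_nonneg t_nonneg)
  ultimately show ?thesis by blast
qed

section \<open>A realization as a weighted graph\<close>

text \<open>Ordered adjacent pairs are grouped by their edge: two for a proper edge, one for a loop.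
  This identifies the denominator of \<open>inv_dist\<close> with \<open>total_deg\<close>.\<close>

lemma handshake:
  "(\<Sum>v\<in>verts N. real (deg N \<epsilon> v)) = 2 * real (card (edge_set N \<epsilon>)) - real (card (loop_set N \<epsilon>))"
proof -
  let ?P = "{(v, w). v \<in> verts N \<and> w \<in> verts N \<and> \<epsilon> {v, w}}"
  let ?E = "edge_set N \<epsilon>" and ?L = "loop_set N \<epsilon>"
  have fV: "finite (verts N)" by (simp add: verts_def)
  have fP: "finite ?P"
    by (rule finite_subset[of _ "verts N \<times> verts N"]) (use fV in auto)
  have E: "?E = (\<lambda>(v, w). {v, w}) ` ?P"
    by (auto simp: edge_set_def pairs_def image_iff)
  then have fE: "finite ?E" using fP by simp
  have LE: "?L \<subseteq> ?E" by (auto simp: loop_set_def)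
  have "(\<Sum>v\<in>verts N. real (deg N \<epsilon> v)) = (\<Sum>z\<in>verts N \<times> verts N. of_bool (\<epsilon> {fst z, snd z}))"
    by (simp add: deg_def sum.cartesian_product case_prod_beta del: sum_of_bool_eq)
  also have "\<dots> = (\<Sum>z\<in>?P. 1)"
    using fV by (intro sum.mono_neutral_cong_right) auto
  also have "\<dots> = (\<Sum>e\<in>?E. \<Sum>z | z \<in> ?P \<and> (\<lambda>(v, w). {v, w}) z = e. 1)"
    unfolding E by (rule sum.image_gen[OF fP])
  also have "\<dots> = (\<Sum>e\<in>?E. 2 - of_bool (e \<in> ?L))"
  proof (intro sum.cong refl)
    fix e assume e: "e \<in> ?E"
    then obtain v w where vw: "e = {v, w}" "(v, w) \<in> ?P" by (auto simp: E)
    then have wv: "(w, v) \<in> ?P" by (auto simp: insert_commute)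
    have eq: "{z. z \<in> ?P \<and> (\<lambda>(v, w). {v, w}) z = e} = {(v, w), (w, v)}" (is "?A = ?B")
    proof (rule set_eqI)
      fix z show "z \<in> ?A \<longleftrightarrow> z \<in> ?B"
        using vw wv by (cases z) (simp add: doubleton_eq_iff, blast)
    qed
    have "e \<in> ?L \<longleftrightarrow> v = w"
      using e vw(1) by (auto simp: loop_set_def)
    then show "(\<Sum>z | z \<in> ?P \<and> (\<lambda>(v, w). {v, w}) z = e. 1) = (2 - of_bool (e \<in> ?L) :: real)"
      unfolding eq by (cases "v = w") auto
  qed
  also have "\<dots> = 2 * real (card ?E) - real (card ?L)"
    using fE LE by (simp add: sum_subtractf Int_absorb1)
  finally show ?thesis .
qed

lemma pmf_rw_step:
  assumes v: "v \<in> verts N" and u: "u \<in> verts N" and pos: "0 < deg N \<epsilon> v"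
  shows "pmf (rw_step N \<epsilon> v) u = of_bool (\<epsilon> {v, u}) / real (deg N \<epsilon> v)"
proof -
  have fin: "finite (nbrs N \<epsilon> v)" by (simp add: nbrs_def verts_def)
  have ne: "nbrs N \<epsilon> v \<noteq> {}"
    using pos deg_eq_card_nbrs[OF v, of \<epsilon>] by auto
  have "u \<in> nbrs N \<epsilon> v \<longleftrightarrow> \<epsilon> {v, u}"
    using u v by (auto simp: nbrs_def edge_set_def pairs_def)
  then show ?thesis
    using ne fin deg_eq_card_nbrs[OF v, of \<epsilon>] by (simp add: rw_step_def indicator_def)
qed

definition adj :: "(nat set \<Rightarrow> bool) \<Rightarrow> nat \<Rightarrow> nat \<Rightarrow> real" where
  "adj \<epsilon> v w = of_bool (\<epsilon> {v, w})"

lemma weighted_graph_adj: "weighted_graph (verts N) (adj \<epsilon>)"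
  by unfold_locales (auto simp: verts_def adj_def insert_commute)

lemma wdeg_adj: "weighted_graph.wdeg (verts N) (adj \<epsilon>) v = real (deg N \<epsilon> v)"
  unfolding weighted_graph.wdeg_def[OF weighted_graph_adj] by (simp add: adj_def deg_def del: sum_of_bool_eq)

text \<open>\<open>0 \<le> K\<close> is recorded because \<open>ennreal\<close> sends negative reals
  to 0, and \<open>K\<close> has to be recovered from it.\<close>

lemma avg_hitting_time_bounds:
  assumes pg: "poincare_graph (verts N) (adj \<epsilon>) gap" and v: "v \<in> verts N"
    and dmin: "0 < dmin" "\<And>v. v \<in> verts N \<Longrightarrow> dmin \<le> real (deg N \<epsilon> v)"
  obtains K where "avg_hitting_time N \<epsilon> v = ennreal K" and "0 \<le> K" and "real N - 2 \<le> K"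
    and "K \<le> real N * (1 + 1 / dmin + 1 / (dmin * gap))"
proof -
  interpret poincare_graph "verts N" "adj \<epsilon>" gap by (rule pg)
  have "pmf (rw_step N \<epsilon> x) u = adj \<epsilon> x u / wdeg x" if "x \<in> verts N" "u \<in> verts N" for x u
    using pmf_rw_step[OF that] wdeg_pos[OF that(1)] by (simp add: wdeg_adj adj_def)
  then have "\<forall>w\<in>verts N. \<exists>h. h w = 0 \<and> (\<forall>v\<in>verts N. 0 \<le> h v
      \<and> (\<integral>\<^sup>+ X. hitting_time w X \<partial>chain_measure (rw_step N \<epsilon>) v) = ennreal (h v)
      \<and> (v \<noteq> w \<longrightarrow> lap h v = wdeg v))"
    using ex_hitting_time_solution[OF pg] by blast
  from bchoice[OF this] obtain h where H: "\<forall>w\<in>verts N. h w w = 0 \<and> (\<forall>v\<in>verts N. 0 \<le> h w v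
      \<and> (\<integral>\<^sup>+ X. hitting_time w X \<partial>chain_measure (rw_step N \<epsilon>) v) = ennreal (h w v)
      \<and> (v \<noteq> w \<longrightarrow> lap (h w) v = wdeg v))" ..
  have h: "\<And>w. w \<in> verts N \<Longrightarrow> h w w = 0"
      "\<And>w v. w \<in> verts N \<Longrightarrow> v \<in> verts N \<Longrightarrow> 0 \<le> h w v"
      "\<And>w v. w \<in> verts N \<Longrightarrow> v \<in> verts N \<Longrightarrow> exp_hitting_time N \<epsilon> v w = ennreal (h w v)"
      "\<And>w v. w \<in> verts N \<Longrightarrow> v \<in> verts N \<Longrightarrow> v \<noteq> w \<Longrightarrow> lap (h w) v = wdeg v"
    using H by (simp_all add: exp_hitting_time_def)
  define K where "K = (\<Sum>w\<in>verts N. wdeg w / total_deg * h w v)"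
  have inv: "inv_dist N \<epsilon> w = wdeg w / total_deg" for w
    by (simp add: inv_dist_def total_deg_def wdeg_adj handshake)
  have D: "0 < total_deg" using total_deg_pos v .
  have nonneg: "0 \<le> wdeg w / total_deg * h w v" if "w \<in> verts N" for w
    using h(2)[OF that v] D wdeg_nonneg by simp
  show thesis
  proof
    have "avg_hitting_time N \<epsilon> v = (\<Sum>w\<in>verts N. ennreal (wdeg w / total_deg * h w v))"
      unfolding avg_hitting_time_def
    proof (intro sum.cong refl)
      fix w assume w: "w \<in> verts N"
      show "ennreal (inv_dist N \<epsilon> w) * exp_hitting_time N \<epsilon> v w = ennreal (wdeg w / total_deg * h w v)"
        by (simp only: inv h(3)[OF w v] ennreal_mult''[OF h(2)[OF w v]])
    qed
    also have "\<dots> = ennreal K"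
      unfolding K_def by (intro sum_ennreal nonneg)
    finally show "avg_hitting_time N \<epsilon> v = ennreal K" .
    show "0 \<le> K"
      unfolding K_def by (intro sum_nonneg nonneg)
    have card: "card (verts N) = N" by (simp add: verts_def)
    note b = average_hitting_time_bounds[OF h(1,4) _ dmin(1) _ v]
    show "real N - 2 \<le> K" "K \<le> real N * (1 + 1 / dmin + 1 / (dmin * gap))"
      unfolding K_def using b dmin(2) by (simp_all add: card wdeg_adj adj_def)
  qed
qed


section \<open>Degrees and cuts in the stochastic block model\<close>

definition cross :: "(nat \<Rightarrow> nat) \<Rightarrow> (nat set \<Rightarrow> bool) \<Rightarrow> nat \<Rightarrow> nat \<Rightarrow> real" where
  "cross b \<epsilon> v w = of_bool (b v \<noteq> b w \<and> \<epsilon> {v, w})"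

lemma weighted_graph_cross: "weighted_graph (verts N) (cross b \<epsilon>)"
  by unfold_locales (auto simp: verts_def cross_def insert_commute)

text \<open>The factors 4 are those of the Chernoff bounds; \<mu>/8 is a quarter of \<mu>/2, the
  lower bound per vertex for an expected cut. Strict inequalities make the complement a union of the
  events bounded there.\<close>

definition good_graph :: "nat \<Rightarrow> (nat \<Rightarrow> nat) \<Rightarrow> real \<Rightarrow> real \<Rightarrow> real \<Rightarrow> (nat set \<Rightarrow> bool) \<Rightarrow> bool" where
  "good_graph N b dmin dmax \<mu> \<epsilon> \<longleftrightarrow>
     (\<forall>v\<in>verts N. dmin / 4 < real (deg N \<epsilon> v)) \<and>
     (\<forall>v\<in>verts N. real (deg N \<epsilon> v) < 4 * dmax) \<and>
     (\<forall>v\<in>verts N. (\<Sum>w\<in>verts N. cross b \<epsilon> v w) < 4 * \<mu>) \<and>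
     (\<forall>S. S \<subseteq> verts N \<and> S \<noteq> {} \<and> 2 * card S \<le> N \<longrightarrow>
        \<mu> / 8 * real (card S) < (\<Sum>v\<in>S. \<Sum>w\<in>verts N - S. cross b \<epsilon> v w))"

lemma avg_hitting_time_good_graph:
  assumes good: "good_graph N b dmin dmax \<mu> \<epsilon>" and pos: "0 < dmin" "0 < dmax" "0 < \<mu>"
    and v: "v \<in> verts N"
  obtains K where "avg_hitting_time N \<epsilon> v = ennreal K" and "0 \<le> K" and "real N - 2 \<le> K"
    and "K \<le> real N * (1 + 4 / dmin + 8192 * dmax / (dmin * \<mu>))"
proof -
  have card: "card (verts N) = N" by (simp add: verts_def)
  have "poincare_graph (verts N) (adj \<epsilon>) ((\<mu> / 8)\<^sup>2 / (2 * (4 * \<mu>)) / (4 * dmax))"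
  proof (rule poincare_graphI[OF weighted_graph_adj weighted_graph_cross])
    show "cross b \<epsilon> v w \<le> adj \<epsilon> v w" for v w
      by (simp add: cross_def adj_def)
    show "\<mu> / 8 * real (card S) \<le> (\<Sum>v\<in>S. \<Sum>w\<in>verts N - S. cross b \<epsilon> v w)"
      if "S \<subseteq> verts N" "S \<noteq> {}" "2 * card S \<le> card (verts N)" for S
      using good that unfolding good_graph_def card by (intro less_imp_le) blast
    show "weighted_graph.wdeg (verts N) (cross b \<epsilon>) v \<le> 4 * \<mu>" if "v \<in> verts N" for v
      using good that unfolding weighted_graph.wdeg_def[OF weighted_graph_cross] good_graph_def
      by (intro less_imp_le) blast
    fix v assume v: "v \<in> verts N"
    show "weighted_graph.wdeg (verts N) (adj \<epsilon>) v \<le> 4 * dmax"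
      using good v unfolding wdeg_adj good_graph_def by (intro less_imp_le) blast
    have "dmin / 4 < real (deg N \<epsilon> v)"
      using good v unfolding good_graph_def by blast
    then show "0 < weighted_graph.wdeg (verts N) (adj \<epsilon>) v"
      using pos unfolding wdeg_adj by linarith
  qed (use pos in auto)
  \<comment> \<open>The constant is 64 * 8 * 4 = 2048; the factor 4 lost in the minimal degree turns
    it into 8192.\<close>
  moreover have "(\<mu> / 8)\<^sup>2 / (2 * (4 * \<mu>)) / (4 * dmax) = \<mu> / (2048 * dmax)"
    using pos by (simp add: power2_eq_square)
  ultimately have pg: "poincare_graph (verts N) (adj \<epsilon>) (\<mu> / (2048 * dmax))"
    by simp
  have dmin: "dmin / 4 \<le> real (deg N \<epsilon> v)" if "v \<in> verts N" for v
    using good that unfolding good_graph_def by (intro less_imp_le) blast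
  from avg_hitting_time_bounds[OF pg v _ dmin] pos obtain K where
    "avg_hitting_time N \<epsilon> v = ennreal K" "0 \<le> K" "real N - 2 \<le> K"
    "K \<le> real N * (1 + 1 / (dmin / 4) + 1 / (dmin / 4 * (\<mu> / (2048 * dmax))))"
    by auto
  then show thesis
    using pos by (intro that[of K]) (simp_all add: mult.commute)
qed

section \<open>The block model at a fixed number of vertices\<close>

locale sbm =
  fixes M N :: nat and b :: "nat \<Rightarrow> nat" and p :: "nat \<Rightarrow> real" and q :: real
  assumes M: "1 \<le> M" and N: "1 \<le> N" and blocks: "equal_blocks M N b"
    and p: "m \<in> {1..M} \<Longrightarrow> p m \<in> {0..1}" and q: "q \<in> {0..1}"
begin

definition \<mu> :: real where
  "\<mu> = (real M - 1) * (real N / real M) * q"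

lemma \<mu>_nonneg: "0 \<le> \<mu>"
  using M q by (simp add: \<mu>_def)

lemma finite_verts [simp]: "finite (verts N)"
  by (simp add: verts_def)

lemma card_verts [simp]: "card (verts N) = N"
  by (simp add: verts_def)

lemma block: "v \<in> verts N \<Longrightarrow> b v \<in> {1..M}"
  using blocks by (auto simp: equal_blocks_def)

lemma card_block: "m \<in> {1..M} \<Longrightarrow> real (card {w \<in> verts N. b w = m}) = real N / real M"
  using blocks by (simp add: equal_blocks_def)

lemma card_other_blocks:
  assumes "v \<in> verts N"
  shows "real (card {w \<in> verts N. b v \<noteq> b w}) = (real M - 1) * (real N / real M)"
proof -
  have "{w \<in> verts N. b v \<noteq> b w} = verts N - {w \<in> verts N. b w = b v}" by auto
  then have "real (card {w \<in> verts N. b v \<noteq> b w}) = real N - real (card {w \<in> verts N. b w = b v})"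
    by (simp add: card_Diff_subset of_nat_diff card_mono[where B = "verts N", simplified])
  then show ?thesis
    using card_block[OF block[OF assms]] M by (simp add: field_simps)
qed

lemma edge_prob_bounds: "e \<in> pairs N \<Longrightarrow> edge_prob b p q e \<in> {0..1}"
  using p block q unfolding pairs_def by (auto simp: edge_prob_pair)

lemma expected_deg:
  assumes "v \<in> verts N"
  shows "(\<Sum>w\<in>verts N. edge_prob b p q {v, w}) = exp_deg M p q N (b v)"
proof -
  have "(\<Sum>w\<in>verts N. edge_prob b p q {v, w}) = (\<Sum>w\<in>verts N. if b w = b v then p (b v) else q)"
    by (intro sum.cong) (auto simp: edge_prob_pair)
  also have "\<dots> = real (card {w \<in> verts N. b w = b v}) * p (b v) + real (card {w \<in> verts N. b v \<noteq> b w}) * q"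
    by (simp add: sum.If_cases Int_def Compl_eq eq_commute[of "b v"])
  finally show ?thesis
    using card_block[OF block[OF assms]] card_other_blocks[OF assms] by (simp add: exp_deg_def)
qed

lemma \<mu>_le_exp_deg: "m \<in> {1..M} \<Longrightarrow> \<mu> \<le> exp_deg M p q N m"
  using p[of m] by (simp add: \<mu>_def exp_deg_def)

lemma exp_deg_min_le: "m \<in> {1..M} \<Longrightarrow> exp_deg_min M p q N \<le> exp_deg M p q N m"
  unfolding exp_deg_min_def by (intro Min_le) auto

lemma exp_deg_max_ge: "m \<in> {1..M} \<Longrightarrow> exp_deg M p q N m \<le> exp_deg_max M p q N"
  unfolding exp_deg_max_def by (intro Max_ge) auto

lemma \<mu>_le_exp_deg_min: "\<mu> \<le> exp_deg_min M p q N"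
  unfolding exp_deg_min_def using M by (subst Min_ge_iff) (auto intro: \<mu>_le_exp_deg)

lemma exp_deg_min_le_max: "exp_deg_min M p q N \<le> exp_deg_max M p q N"
  using exp_deg_min_le[of 1] exp_deg_max_ge[of 1] M by fastforce

text \<open>With s = \<open>card S\<close> and c_m vertices of \<open>S\<close> in block m, the
  number of cross pairs leaving \<open>S\<close> is s((M-1)N/M - s) + \<Sum> c_m^2. By
  Cauchy-Schwarz the last sum is at least s^2/M, so evenly spread sets are the worst case. The total
  is at least s(1 - 1/M)(N - s), and s is at most N/2.\<close>

lemma cut_size:
  assumes S: "S \<subseteq> verts N" "2 * card S \<le> N"
  shows "(real M - 1) * (real N / real M) / 2 * real (card S)
    \<le> (\<Sum>v\<in>S. \<Sum>w\<in>verts N - S. of_bool (b v \<noteq> b w))"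
proof -
  let ?s = "real (card S)"
  have fS: "finite S" using S(1) by (rule finite_subset) simp
  have M0: "0 < real M" using M by simp
  have "(\<Sum>w\<in>verts N - S. of_bool (b v \<noteq> b w))
      = (real M - 1) * (real N / real M) - (?s - (\<Sum>w\<in>S. of_bool (b v = b w)))" if v: "v \<in> S" for v
  proof -
    have "(\<Sum>w\<in>verts N - S. of_bool (b v \<noteq> b w) :: real)
        = (\<Sum>w\<in>verts N. of_bool (b v \<noteq> b w)) - (\<Sum>w\<in>S. of_bool (b v \<noteq> b w))"
      using S by (intro sum_diff) auto
    also have "(\<Sum>w\<in>verts N. of_bool (b v \<noteq> b w)) = real (card {w \<in> verts N. b v \<noteq> b w})"
      by (simp add: Int_def)
    also have "\<dots> = (real M - 1) * (real N / real M)"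
      using v S by (intro card_other_blocks) auto
    also have "(\<Sum>w\<in>S. of_bool (b v \<noteq> b w)) = (\<Sum>w\<in>S. 1 - of_bool (b v = b w) :: real)"
      by (intro sum.cong) auto
    finally show ?thesis
      by (simp add: sum_subtractf del: sum_of_bool_eq)
  qed
  then have "(\<Sum>v\<in>S. \<Sum>w\<in>verts N - S. of_bool (b v \<noteq> b w))
      = (\<Sum>v\<in>S. (real M - 1) * (real N / real M) - (?s - (\<Sum>w\<in>S. of_bool (b v = b w))))"
    by (rule sum.cong[OF refl])
  also have "\<dots> = ?s * ((real M - 1) * (real N / real M) - ?s) + (\<Sum>v\<in>S. \<Sum>w\<in>S. of_bool (b v = b w))"
    by (simp only: sum_subtractf sum_constant of_nat_mult right_diff_distrib)
  finally have "(\<Sum>v\<in>S. \<Sum>w\<in>verts N - S. of_bool (b v \<noteq> b w))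
      = ?s * ((real M - 1) * (real N / real M) - ?s) + (\<Sum>v\<in>S. \<Sum>w\<in>S. of_bool (b v = b w))" .
  moreover have "?s\<^sup>2 / real M \<le> (\<Sum>v\<in>S. \<Sum>w\<in>S. of_bool (b v = b w))"
  proof -
    let ?c = "\<lambda>m. \<Sum>v\<in>S. of_bool (b v = m) :: real"
    have "?s = (\<Sum>v\<in>S. \<Sum>m\<in>{1..M}. of_bool (b v = m))"
      using block S(1) by (subst sum.cong[OF refl, of _ _ "\<lambda>_. 1"]) (auto simp: of_bool_def sum.delta' subset_iff)
    also have "\<dots> = (\<Sum>m\<in>{1..M}. ?c m)"
      by (rule sum.swap)
    finally have "?s\<^sup>2 \<le> (\<Sum>m\<in>{1..M}. (?c m)\<^sup>2) * real (card {1..M})"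
      using sum_squared_le_sum_of_squares[of ?c "{1..M}"] by metis
    also have "(\<Sum>m\<in>{1..M}. (?c m)\<^sup>2)
        = (\<Sum>m\<in>{1..M}. \<Sum>v\<in>S. \<Sum>w\<in>S. of_bool (b v = m) * of_bool (b w = m))"
      by (simp only: power2_eq_square sum_product)
    also have "\<dots> = (\<Sum>v\<in>S. \<Sum>w\<in>S. \<Sum>m\<in>{1..M}. of_bool (b v = m) * of_bool (b w = m))"
      by (rule trans[OF sum.swap]) (rule sum.cong[OF refl], rule sum.swap)
    also have "\<dots> = (\<Sum>v\<in>S. \<Sum>w\<in>S. of_bool (b v = b w))"
    proof (intro sum.cong refl)
      fix v w assume "v \<in> S"
      then have "b v \<in> {1..M}" using S(1) block by auto
      moreover have "(\<Sum>m\<in>{1..M}. of_bool (b v = m) * of_bool (b w = m))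
          = (\<Sum>m\<in>{1..M}. if m = b v then of_bool (b v = b w) else 0 :: real)"
        by (intro sum.cong) auto
      ultimately show "(\<Sum>m\<in>{1..M}. of_bool (b v = m) * of_bool (b w = m)) = (of_bool (b v = b w) :: real)"
        by simp
    qed
    finally show ?thesis
      using M0 by (simp add: pos_divide_le_eq)
  qed
  moreover have "?s * ((real M - 1) * (real N / real M) - ?s) + ?s\<^sup>2 / real M
      - (real M - 1) * (real N / real M) / 2 * ?s = (real M - 1) / real M * ?s * (real N - 2 * ?s) / 2"
    using M0 by (simp add: field_simps power2_eq_square)
  moreover have "0 \<le> (real M - 1) / real M * ?s * (real N - 2 * ?s) / 2"
    using M S(2) by simp
  ultimately show ?thesis by linarith
qed

section \<open>Tail bounds for degrees and cuts\<close>

abbreviation G where "G \<equiv> measure_pmf.prob (sbm_pmf N b p q)"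

lemma finite_pairs: "finite (pairs N)"
proof -
  have "pairs N = (\<lambda>(v, w). {v, w}) ` (verts N \<times> verts N)"
    by (auto simp: pairs_def image_iff)
  then show ?thesis by simp
qed

text \<open>The sums run over vertices or ordered pairs, whereas independence concerns unordered
  pairs; injectivity of \<open>e\<close> ensures that no edge is counted twice.\<close>

lemma edge_sum_lower_tail:
  assumes "e ` I \<subseteq> pairs N" "inj_on e I" "0 \<le> c" "c \<le> (\<Sum>i\<in>I. edge_prob b p q (e i))"
  shows "G {\<epsilon>. (\<Sum>i\<in>I. of_bool (\<epsilon> (e i))) \<le> c / 4} \<le> exp (- c / 4)"
  using chernoff_bernoulli_lower[where \<pi> = "edge_prob b p q", OF finite_pairs assms(1) edge_prob_bounds assms(3)] assms(2,4)
  unfolding sbm_pmf_def by (simp only: sum.reindex o_def)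

lemma edge_sum_upper_tail:
  assumes "e ` I \<subseteq> pairs N" "inj_on e I" "(\<Sum>i\<in>I. edge_prob b p q (e i)) \<le> c"
  shows "G {\<epsilon>. 4 * c \<le> (\<Sum>i\<in>I. of_bool (\<epsilon> (e i)))} \<le> exp (- c)"
  using chernoff_bernoulli_upper[where \<pi> = "edge_prob b p q", OF finite_pairs assms(1) edge_prob_bounds] assms(2,3)
  unfolding sbm_pmf_def by (simp only: sum.reindex o_def)

lemma inj_on_pair: "inj_on (\<lambda>w. {v, w}) A"
  by (auto simp: inj_on_def doubleton_eq_iff)

lemma pair_image: "v \<in> verts N \<Longrightarrow> A \<subseteq> verts N \<Longrightarrow> (\<lambda>w. {v, w}) ` A \<subseteq> pairs N"
  by (auto simp: pairs_def)

text \<open>The exponent is weakened to \<mu>/8, the one of the cut bound per vertex, so that all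
  events share the same small quantity.\<close>

lemma deg_lower_tail:
  assumes v: "v \<in> verts N"
  shows "G {\<epsilon>. real (deg N \<epsilon> v) \<le> exp_deg_min M p q N / 4} \<le> exp (- \<mu> / 8)"
proof -
  have "G {\<epsilon>. real (deg N \<epsilon> v) \<le> exp_deg_min M p q N / 4} \<le> exp (- exp_deg_min M p q N / 4)"
    using edge_sum_lower_tail[OF pair_image[OF v subset_refl] inj_on_pair, of "exp_deg_min M p q N"]
      \<mu>_nonneg \<mu>_le_exp_deg_min exp_deg_min_le[OF block[OF v]] expected_deg[OF v]
    by (simp add: deg_def del: sum_of_bool_eq)
  also have "\<dots> \<le> exp (- \<mu> / 8)"
    using \<mu>_nonneg \<mu>_le_exp_deg_min by simp
  finally show ?thesis .
qed

lemma deg_upper_tail: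
  assumes v: "v \<in> verts N"
  shows "G {\<epsilon>. 4 * exp_deg_max M p q N \<le> real (deg N \<epsilon> v)} \<le> exp (- \<mu> / 8)"
proof -
  have "G {\<epsilon>. 4 * exp_deg_max M p q N \<le> real (deg N \<epsilon> v)} \<le> exp (- exp_deg_max M p q N)"
    using edge_sum_upper_tail[OF pair_image[OF v subset_refl] inj_on_pair, of "exp_deg_max M p q N"]
      exp_deg_max_ge[OF block[OF v]] expected_deg[OF v]
    by (simp add: deg_def del: sum_of_bool_eq)
  also have "\<dots> \<le> exp (- \<mu> / 8)"
    using \<mu>_nonneg \<mu>_le_exp_deg_min exp_deg_min_le_max by simp
  finally show ?thesis .
qed

lemma cross_deg_upper_tail:
  assumes v: "v \<in> verts N"
  shows "G {\<epsilon>. 4 * \<mu> \<le> (\<Sum>w\<in>verts N. cross b \<epsilon> v w)} \<le> exp (- \<mu> / 8)"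
proof -
  let ?I = "{w \<in> verts N. b v \<noteq> b w}"
  have "(\<Sum>w\<in>verts N. cross b \<epsilon> v w) = (\<Sum>w\<in>?I. of_bool (\<epsilon> {v, w}))" for \<epsilon>
    by (intro sum.mono_neutral_cong_right) (auto simp: cross_def)
  moreover have "(\<Sum>w\<in>?I. edge_prob b p q {v, w}) = \<mu>"
  proof -
    have "(\<Sum>w\<in>?I. edge_prob b p q {v, w}) = (\<Sum>w\<in>?I. q)"
      by (intro sum.cong) (auto simp: edge_prob_pair)
    then show ?thesis
      using card_other_blocks[OF v] by (simp add: \<mu>_def)
  qed
  ultimately have "G {\<epsilon>. 4 * \<mu> \<le> (\<Sum>w\<in>verts N. cross b \<epsilon> v w)} \<le> exp (- \<mu>)"
    using edge_sum_upper_tail[OF pair_image[OF v, of ?I] inj_on_pair, of \<mu>]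
    by (simp del: sum_of_bool_eq)
  also have "\<dots> \<le> exp (- \<mu> / 8)"
    using \<mu>_nonneg by simp
  finally show ?thesis .
qed

text \<open>The expected cut is at least \<mu>/2 per vertex of \<open>S\<close>, and Chernoff's
  bound puts a factor 1/4 into both threshold and exponent. The form as a power of
  \<open>card S\<close> prepares the sum over all sets.\<close>

lemma cut_lower_tail:
  assumes S: "S \<subseteq> verts N" "2 * card S \<le> N"
  shows "G {\<epsilon>. (\<Sum>v\<in>S. \<Sum>w\<in>verts N - S. cross b \<epsilon> v w) \<le> \<mu> / 8 * real (card S)} \<le> exp (- \<mu> / 8) ^ card S"
proof -
  let ?I = "{(v, w). v \<in> S \<and> w \<in> verts N - S \<and> b v \<noteq> b w}"
  let ?e = "\<lambda>(v, w). {v, w :: nat}"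
  have fS: "finite S" using S(1) by (rule finite_subset) simp
  have I: "?I \<subseteq> S \<times> (verts N - S)" by auto
  \<comment> \<open>Exactly one endpoint lies in \<open>S\<close>, which fixes the orientation of
    the pair.\<close>
  have inj: "inj_on ?e ?I"
    by (auto simp: inj_on_def doubleton_eq_iff)
  have sum_I: "(\<Sum>v\<in>S. \<Sum>w\<in>verts N - S. of_bool (b v \<noteq> b w) * f v w) = (\<Sum>z\<in>?I. case z of (v, w) \<Rightarrow> f v w)"
    for f :: "nat \<Rightarrow> nat \<Rightarrow> real"
    unfolding sum.cartesian_product
    using fS by (intro sum.mono_neutral_cong_right) (auto simp del: mult_eq_0_iff)
  have "(\<Sum>v\<in>S. \<Sum>w\<in>verts N - S. cross b \<epsilon> v w) = (\<Sum>z\<in>?I. of_bool (\<epsilon> (?e z)))" for \<epsilon>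
    using sum_I[of "\<lambda>v w. of_bool (\<epsilon> {v, w})"]
    by (simp add: cross_def of_bool_conj case_prod_beta del: sum_of_bool_eq)
  moreover have "\<mu> / 2 * real (card S) \<le> (\<Sum>z\<in>?I. edge_prob b p q (?e z))"
  proof -
    have "q * ((real M - 1) * (real N / real M) / 2 * real (card S))
        \<le> q * (\<Sum>v\<in>S. \<Sum>w\<in>verts N - S. of_bool (b v \<noteq> b w))"
      using q by (intro mult_left_mono cut_size S) auto
    also have "\<dots> = (\<Sum>v\<in>S. \<Sum>w\<in>verts N - S. of_bool (b v \<noteq> b w) * q)"
      by (simp add: sum_distrib_left mult.commute del: sum_of_bool_eq sum_mult_of_bool_eq sum_of_bool_mult_eq)
    also have "\<dots> = (\<Sum>z\<in>?I. case z of (v, w) \<Rightarrow> q)"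
      by (rule sum_I)
    also have "\<dots> = (\<Sum>z\<in>?I. edge_prob b p q (?e z))"
      by (intro sum.cong) (auto simp: edge_prob_pair)
    finally show ?thesis by (simp add: \<mu>_def mult_ac)
  qed
  moreover have "?e ` ?I \<subseteq> pairs N"
    using S(1) by (auto simp: pairs_def)
  ultimately have "G {\<epsilon>. (\<Sum>v\<in>S. \<Sum>w\<in>verts N - S. cross b \<epsilon> v w) \<le> \<mu> / 2 * real (card S) / 4}
      \<le> exp (- (\<mu> / 2 * real (card S)) / 4)"
    using edge_sum_lower_tail[of ?e ?I "\<mu> / 2 * real (card S)"] inj \<mu>_nonneg by simp
  also have "\<dots> = exp (- \<mu> / 8) ^ card S"
    by (simp flip: exp_of_nat_mult)
  finally show ?thesis by simp
qed

text \<open>Decay exponential in \<open>card S\<close> beats the number of sets: with y =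
  exp(-\<mu>/8), the sum of y^|S| over nonempty \<open>S\<close> is (1 + y)^N - 1, at most exp(Ny) -
  1. The three families of events at vertices cost \<open>x\<close> each.\<close>

lemma prob_not_good_graph:
  defines "x \<equiv> real N * exp (- \<mu> / 8)"
  shows "G {\<epsilon>. \<not> good_graph N b (exp_deg_min M p q N) (exp_deg_max M p q N) \<mu> \<epsilon>} \<le> 3 * x + (exp x - 1)"
proof -
  let ?y = "exp (- \<mu> / 8)"
  let ?T = "{S. S \<subseteq> verts N \<and> S \<noteq> {} \<and> 2 * card S \<le> N}"
  let ?A = "\<lambda>v. {\<epsilon>. real (deg N \<epsilon> v) \<le> exp_deg_min M p q N / 4}"
  let ?B = "\<lambda>v. {\<epsilon>. 4 * exp_deg_max M p q N \<le> real (deg N \<epsilon> v)}"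
  let ?C = "\<lambda>v. {\<epsilon>. 4 * \<mu> \<le> (\<Sum>w\<in>verts N. cross b \<epsilon> v w)}"
  let ?D = "\<lambda>S. {\<epsilon>. (\<Sum>v\<in>S. \<Sum>w\<in>verts N - S. cross b \<epsilon> v w) \<le> \<mu> / 8 * real (card S)}"
  have union: "G (\<Union>i\<in>I. A i) \<le> (\<Sum>i\<in>I. c i)" if "finite I" "\<And>i. i \<in> I \<Longrightarrow> G (A i) \<le> c i"
    for I :: "'i set" and A and c :: "'i \<Rightarrow> real"
  proof -
    have "G (\<Union>i\<in>I. A i) \<le> (\<Sum>i\<in>I. G (A i))"
      by (intro measure_pmf.finite_measure_subadditive_finite that(1)) auto
    also have "\<dots> \<le> (\<Sum>i\<in>I. c i)"
      by (intro sum_mono that(2))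
    finally show ?thesis .
  qed
  have fT: "finite ?T"
    by (rule finite_subset[of _ "Pow (verts N)"]) auto
  have A: "G (\<Union>v\<in>verts N. ?A v) \<le> x"
    using union[of "verts N" ?A "\<lambda>_. ?y"] deg_lower_tail by (simp add: x_def)
  have B: "G (\<Union>v\<in>verts N. ?B v) \<le> x"
    using union[of "verts N" ?B "\<lambda>_. ?y"] deg_upper_tail by (simp add: x_def)
  have C: "G (\<Union>v\<in>verts N. ?C v) \<le> x"
    using union[of "verts N" ?C "\<lambda>_. ?y"] cross_deg_upper_tail by (simp add: x_def)
  have "G (\<Union>S\<in>?T. ?D S) \<le> (\<Sum>S\<in>?T. ?y ^ card S)"
    by (intro union fT cut_lower_tail) auto
  also have "\<dots> \<le> (\<Sum>S\<in>Pow (verts N) - {{}}. ?y ^ card S)"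
    by (intro sum_mono2) auto
  also have "\<dots> = (\<Sum>S\<in>Pow (verts N). ?y ^ card S) - 1"
    by (subst sum_diff1) auto
  also have "(\<Sum>S\<in>Pow (verts N). ?y ^ card S) = (?y + 1) ^ N"
    using prod_add[of "verts N" "\<lambda>_. ?y" "\<lambda>_. 1"] by simp
  also have "\<dots> \<le> exp ?y ^ N"
    using exp_ge_add_one_self[of ?y] by (intro power_mono) (auto simp: add.commute)
  also have "\<dots> = exp x"
    by (simp add: x_def flip: exp_of_nat_mult)
  finally have D: "G (\<Union>S\<in>?T. ?D S) \<le> exp x - 1" by simp
  have "{\<epsilon>. \<not> good_graph N b (exp_deg_min M p q N) (exp_deg_max M p q N) \<mu> \<epsilon>}
      \<subseteq> (\<Union>v\<in>verts N. ?A v) \<union> ((\<Union>v\<in>verts N. ?B v) \<union> ((\<Union>v\<in>verts N. ?C v) \<union> (\<Union>S\<in>?T. ?D S)))"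
    (is "_ \<subseteq> ?UA \<union> (?UB \<union> (?UC \<union> ?UD))")
    unfolding good_graph_def by (auto simp: not_less)
  then have "G {\<epsilon>. \<not> good_graph N b (exp_deg_min M p q N) (exp_deg_max M p q N) \<mu> \<epsilon>}
      \<le> G (?UA \<union> (?UB \<union> (?UC \<union> ?UD)))"
    by (intro measure_pmf.finite_measure_mono) auto
  also have "\<dots> \<le> G ?UA + G (?UB \<union> (?UC \<union> ?UD))"
    by (intro measure_Un_le) auto
  also have "G (?UB \<union> (?UC \<union> ?UD)) \<le> G ?UB + G (?UC \<union> ?UD)"
    by (intro measure_Un_le) auto
  also have "G (?UC \<union> ?UD) \<le> G ?UC + G ?UD"
    by (intro measure_Un_le) auto
  finally show ?thesis
    using A B C D by linarith
qed

end


section \<open>Asymptotics\<close>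

text \<open>Used with x = (N/M) p_min, y = \<mu>, L = ln N and R = gamma_max/gamma_min. If y were
  below L^3, then x would be at least (3/4) L^4 and \<open>mix\<close> would give (3/4)^7 L^28 \<le>
  L^24, false for L \<ge> 4. Hence y \<ge> 1, so x^7 \<le> y^8 \<le> y^14 gives x \<le> y^2, and
  \<open>deg\<close> becomes L^4 R^2 \<le> 2 y^2.\<close>

lemma growth_bounds:
  fixes x y L R :: real
  assumes x: "0 \<le> x" and y: "0 < y" and L: "4 \<le> L" and R: "1 \<le> R"
    and deg: "L ^ 4 * R\<^sup>2 \<le> x + y" and mix: "x ^ 7 \<le> y ^ 8"
  shows "L ^ 3 \<le> y" and "R \<le> 2 * y / L\<^sup>2" and "L ^ 4 \<le> x + y"
proof -
  have "L ^ 4 * 1 \<le> L ^ 4 * R\<^sup>2"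
    using L R by (intro mult_left_mono) (auto simp: one_le_power)
  then show xy: "L ^ 4 \<le> x + y" using deg by simp
  show y3: "L ^ 3 \<le> y"
  proof (rule ccontr)
    assume "\<not> L ^ 3 \<le> y"
    then have y': "y \<le> L ^ 3" by simp
    then have "y ^ 8 \<le> (L ^ 3) ^ 8" using y by (intro power_mono) auto
    also have "\<dots> = L ^ 24" by (simp flip: power_mult)
    finally have up: "y ^ 8 \<le> L ^ 24" .
    have "4 * L ^ 3 \<le> L ^ 4"
      using L by (simp add: power4_eq_xxxx power3_eq_cube mult_right_mono)
    then have "3 / 4 * L ^ 4 \<le> x" using xy y' by linarith
    then have "(3 / 4 * L ^ 4) ^ 7 \<le> x ^ 7" using L by (intro power_mono) auto
    also have "(3 / 4 * L ^ 4) ^ 7 = (3 / 4) ^ 7 * (L ^ 4) ^ 7"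
      by (rule power_mult_distrib)
    also have "(L ^ 4) ^ 7 = L ^ 4 * L ^ 24"
      by (simp flip: power_mult power_add)
    finally have "(3 / 4) ^ 7 * (L ^ 4 * L ^ 24) \<le> L ^ 24"
      using up mix by linarith
    then have "(3 / 4) ^ 7 * L ^ 4 * L ^ 24 \<le> 1 * L ^ 24"
      by (simp only: mult.assoc mult_1)
    then have "(3 / 4) ^ 7 * L ^ 4 \<le> 1"
      by (rule mult_right_le_imp_le) (use L in simp)
    moreover have "4 ^ 4 \<le> L ^ 4" using L by (intro power_mono) auto
    ultimately show False by (simp add: power_divide)
  qed
  have "1 \<le> L ^ 3" using L by (intro one_le_power) auto
  then have y1: "1 \<le> y" using y3 by linarith
  have "x ^ 7 \<le> (y\<^sup>2) ^ 7"
    using mix power_increasing[of 8 14 y] y1 by (simp flip: power_mult)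
  then have "x \<le> y\<^sup>2"
    by (rule power_le_imp_le_base[of x 6, simplified]) (use y1 in auto)
  moreover have "y \<le> y\<^sup>2" using y1 by (simp add: self_le_power)
  moreover have "(L\<^sup>2 * R)\<^sup>2 = L ^ 4 * R\<^sup>2" by (simp add: power_mult_distrib flip: power_mult)
  ultimately have "(L\<^sup>2 * R)\<^sup>2 \<le> 2 * y\<^sup>2" using deg by linarith
  also have "\<dots> \<le> (2 * y)\<^sup>2" by (simp add: power_mult_distrib)
  finally have "L\<^sup>2 * R \<le> 2 * y"
    by (rule power2_le_imp_le) (use y in auto)
  then show "R \<le> 2 * y / L\<^sup>2"
    using L by (simp add: pos_le_divide_eq mult.commute)
qed

text \<open>\<open>0 < k\<close> guards the case \<open>x = 0\<close>, because
  \<open>0 powr 0 = 0\<close> but \<open>0 ^ 0 = 1\<close>.\<close>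

lemma powr_quarters_pow4:
  fixes x :: real
  assumes "0 \<le> x" and "0 < k"
  shows "(x powr (real k / 4)) ^ 4 = x ^ k"
proof (cases "x = 0")
  case False
  then have "(x powr (real k / 4)) ^ 4 = x powr (real k / 4 * 4)"
    using assms by (simp add: powr_power)
  then show ?thesis using False assms by (simp add: powr_realpow)
qed (use assms in simp)

section \<open>Explicit error bounds at a fixed number of vertices\<close>

context sbm
begin

lemma prob_avg_hitting_time:
  assumes \<mu>: "0 < \<mu>" and v: "v \<in> verts N"
    and x: "real N * exp (- \<mu> / 8) \<le> x"
    and \<delta>: "2 / real N + 4 / exp_deg_min M p q N
      + 8192 * exp_deg_max M p q N / (exp_deg_min M p q N * \<mu>) \<le> \<delta>"
  shows "1 - (3 * x + (exp x - 1))
    \<le> G {\<epsilon>. \<bar>enn2ereal (avg_hitting_time N \<epsilon> v) / ereal (real N) - 1\<bar> \<le> ereal \<delta>}"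
proof -
  let ?dmin = "exp_deg_min M p q N" and ?dmax = "exp_deg_max M p q N"
  let ?good = "{\<epsilon>. good_graph N b ?dmin ?dmax \<mu> \<epsilon>}"
  have pos: "0 < ?dmin" "0 < ?dmax"
    using \<mu> \<mu>_le_exp_deg_min exp_deg_min_le_max by linarith+
  have N0: "0 < real N" using N by simp
  have "?good \<subseteq> {\<epsilon>. \<bar>enn2ereal (avg_hitting_time N \<epsilon> v) / ereal (real N) - 1\<bar> \<le> ereal \<delta>}"
  proof safe
    fix \<epsilon> assume "good_graph N b ?dmin ?dmax \<mu> \<epsilon>"
    then obtain K where K: "avg_hitting_time N \<epsilon> v = ennreal K" "0 \<le> K" "real N - 2 \<le> K"
      "K \<le> real N * (1 + 4 / ?dmin + 8192 * ?dmax / (?dmin * \<mu>))"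
      using avg_hitting_time_good_graph pos \<mu> v by blast
    have "K / real N \<le> 1 + 4 / ?dmin + 8192 * ?dmax / (?dmin * \<mu>)"
      using K(4) N0 by (simp add: pos_divide_le_eq mult.commute)
    moreover have "1 - 2 / real N \<le> K / real N"
      using divide_right_mono[OF K(3), of "real N"] N0 by (simp add: diff_divide_distrib)
    moreover have "0 \<le> 2 / real N" "0 \<le> 4 / ?dmin" "0 \<le> 8192 * ?dmax / (?dmin * \<mu>)"
      using N0 pos \<mu> by simp_all
    ultimately have "\<bar>K / real N - 1\<bar> \<le> \<delta>"
      using \<delta> by linarith
    then show "\<bar>enn2ereal (avg_hitting_time N \<epsilon> v) / ereal (real N) - 1\<bar> \<le> ereal \<delta>"
      using N0 by (simp add: K(1,2) one_ereal_def)
  qed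
  then have "G ?good \<le> G {\<epsilon>. \<bar>enn2ereal (avg_hitting_time N \<epsilon> v) / ereal (real N) - 1\<bar> \<le> ereal \<delta>}"
    by (intro measure_pmf.finite_measure_mono) auto
  moreover have "G ?good = 1 - G {\<epsilon>. \<not> good_graph N b ?dmin ?dmax \<mu> \<epsilon>}"
    using measure_pmf.prob_compl[of ?good "sbm_pmf N b p q"] by (simp add: Compl_eq Compl_eq_Diff_UNIV[symmetric])
  moreover have "exp (real N * exp (- \<mu> / 8)) \<le> exp x"
    using x by simp
  ultimately show ?thesis
    using prob_not_good_graph x by linarith
qed

lemma prob_avg_hitting_time_log:
  defines "L \<equiv> ln (real N)"
  assumes L: "4 \<le> L"
    and mono: "\<And>m. m \<in> {1..M} \<Longrightarrow> p M \<le> p m"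
    and deg: "real M * L ^ 4 / (real N * p M + real N * (real M - 1) * q)
      * ((exp_deg_max M p q N)\<^sup>2 / (exp_deg_min M p q N)\<^sup>2) < 1"
    and q0: "((real M - 1) * q)\<^sup>2 \<noteq> 0"
    and mix: "(real M * L / real N) powr (1/4) * p_min M p powr (5/4) * p_max M p powr (1/2)
      / ((real M - 1) * q)\<^sup>2 < 1"
    and v: "v \<in> verts N"
  shows "1 - (3 * (1 / real N) + (exp (1 / real N) - 1))
    \<le> G {\<epsilon>. \<bar>enn2ereal (avg_hitting_time N \<epsilon> v) / ereal (real N) - 1\<bar>
        \<le> ereal (2 / real N + 4 / L ^ 4 + 16384 / L\<^sup>2)}"
proof -
  let ?dmin = "exp_deg_min M p q N" and ?dmax = "exp_deg_max M p q N"
  define n where "n = real N / real M"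
  have N0: "0 < real N" and M0: "0 < real M" using N M by simp_all
  then have n0: "0 < n" by (simp add: n_def)
  have pM: "0 \<le> p M" using p[of M] M by simp
  have pmin: "p_min M p = p M"
    unfolding p_min_def using M mono by (intro Min_eqI) auto
  have pmax: "p M \<le> p_max M p"
    unfolding p_max_def using M by (intro Max_ge) auto
  have dmin: "?dmin = n * p M + \<mu>"
    unfolding exp_deg_min_def
  proof (rule Min_eqI)
    show "n * p M + \<mu> \<in> exp_deg M p q N ` {1..M}"
      using M by (intro image_eqI[of _ _ M]) (auto simp: exp_deg_def \<mu>_def n_def)
    fix d assume "d \<in> exp_deg M p q N ` {1..M}"
    then show "n * p M + \<mu> \<le> d"
      using mono n0 by (auto simp: exp_deg_def \<mu>_def simp flip: n_def intro!: mult_left_mono)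
  qed simp
  have \<mu>_eq: "\<mu> = n * ((real M - 1) * q)"
    by (simp add: \<mu>_def n_def)
  \<comment> \<open>\<open>q0\<close> supplies this, and with it excludes \<open>M = 1\<close>. The
    bound \<open>mix\<close> cannot: division by zero makes it trivially true for vanishing
    denominator.\<close>
  have "\<mu> \<noteq> 0"
    using q0 n0 by (auto simp: \<mu>_eq)
  then have \<mu>0: "0 < \<mu>"
    using \<mu>_nonneg by linarith
  have dmin0: "0 < ?dmin"
    using \<mu>0 \<mu>_le_exp_deg_min by linarith
  define R where "R = ?dmax / ?dmin"
  have R: "1 \<le> R"
    using dmin0 exp_deg_min_le_max by (simp add: R_def)
  \<comment> \<open>Block \<open>M\<close> has the least expected degree, so \<open>deg\<close>
    bounds L^4 R^2 by gamma_min.\<close>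
  have "real N * p M + real N * (real M - 1) * q = real M * ?dmin"
    using M0 by (simp add: dmin \<mu>_eq n_def field_simps)
  then have "L ^ 4 / ?dmin * R\<^sup>2 < 1"
    using deg M0 by (simp add: R_def power_divide)
  then have deg': "L ^ 4 * R\<^sup>2 \<le> n * p M + \<mu>"
    using dmin0 by (simp add: dmin[symmetric] field_simps)
  \<comment> \<open>The fourth power clears the fractional exponents. Multiplying by
    \<open>n ^ 8\<close> turns the right-hand side into \<mu>^8 and the logarithmic factor into
    \<open>L\<close>; then \<open>L\<close> is bounded below by 1 and \<open>p_max\<close> by
    \<open>p M\<close>.\<close>
  have "(n * p M) ^ 7 \<le> \<mu> ^ 8"
  proof -
    let ?T = "real M * L / real N" and ?a = "(real M - 1) * q"
    have T0: "0 \<le> ?T" using L M0 N0 by simp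
    let ?f = "?T powr (1/4) * p M powr (5/4) * p_max M p powr (1/2)"
    have "?f \<le> ?a\<^sup>2"
      using mix q0 by (simp add: pmin field_simps)
    then have "?f ^ 4 \<le> (?a\<^sup>2) ^ 4"
      by (intro power_mono) auto
    also have "?f ^ 4 = ?T * p M ^ 5 * p_max M p ^ 2"
      using powr_quarters_pow4[of ?T 1] powr_quarters_pow4[of "p M" 5] powr_quarters_pow4[of "p_max M p" 2]
        T0 pM pmax by (simp add: power_mult_distrib)
    also have "(?a\<^sup>2) ^ 4 = ?a ^ 8"
      by (simp flip: power_mult)
    finally have "n ^ 8 * (?T * p M ^ 5 * p_max M p ^ 2) \<le> n ^ 8 * ?a ^ 8"
      using n0 by (intro mult_left_mono) auto
    also have "\<dots> = \<mu> ^ 8"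
      by (simp only: \<mu>_eq power_mult_distrib)
    also have "n ^ 8 * (?T * p M ^ 5 * p_max M p ^ 2) = (n * ?T) * (n ^ 7 * (p M ^ 5 * p_max M p ^ 2))"
      by (simp add: power_Suc[of n 7, simplified])
    also have "n * ?T = L"
      using M0 N0 by (simp add: n_def)
    finally have "L * (n ^ 7 * (p M ^ 5 * p_max M p ^ 2)) \<le> \<mu> ^ 8" .
    moreover have "1 * (n ^ 7 * (p M ^ 5 * p M ^ 2)) \<le> L * (n ^ 7 * (p M ^ 5 * p_max M p ^ 2))"
      using L n0 pM pmax by (intro mult_mono power_mono) auto
    moreover have "(n * p M) ^ 7 = 1 * (n ^ 7 * (p M ^ 5 * p M ^ 2))"
      by (simp add: power_mult_distrib flip: power_add)
    ultimately show ?thesis by linarith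
  qed
  note growth = growth_bounds[OF _ \<mu>0 L R deg' this]
  have g: "L ^ 3 \<le> \<mu>" "R \<le> 2 * \<mu> / L\<^sup>2" "L ^ 4 \<le> ?dmin"
    using growth n0 pM by (simp_all add: dmin)
  show ?thesis
  proof (rule prob_avg_hitting_time[OF \<mu>0 v])
    \<comment> \<open>From L \<ge> 4 and L^3 \<le> \<mu> follows \<mu>/8 \<ge> 2L, so exp(-\<mu>/8)
      is at most N^(-2).\<close>
    have "4 * 4 * L \<le> L * L * L"
      using L by (intro mult_mono) auto
    then have "2 * L \<le> \<mu> / 8"
      using g(1) by (simp add: power3_eq_cube)
    then have "real N * exp (- \<mu> / 8) \<le> real N * exp (- (L + L))"
      using N0 by (intro mult_left_mono) auto
    also have "exp (- (L + L)) = 1 / (real N * real N)"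
      using N0 by (simp only: exp_minus exp_add L_def) (simp add: divide_inverse)
    finally show "real N * exp (- \<mu> / 8) \<le> 1 / real N"
      using N0 by simp
    have "4 / ?dmin \<le> 4 / L ^ 4"
      using g(3) L by (intro divide_left_mono) (auto simp: dmin0)
    moreover have "8192 * ?dmax / (?dmin * \<mu>) \<le> 16384 / L\<^sup>2"
    proof -
      have "8192 * ?dmax / (?dmin * \<mu>) = 8192 / \<mu> * R"
        by (simp add: R_def)
      also have "\<dots> \<le> 8192 / \<mu> * (2 * \<mu> / L\<^sup>2)"
        using g(2) \<mu>0 by (intro mult_left_mono) auto
      also have "\<dots> = 16384 / L\<^sup>2"
        using \<mu>0 by simp
      finally show ?thesis .
    qed
    ultimately show "2 / real N + 4 / ?dmin + 8192 * ?dmax / (?dmin * \<mu>)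
        \<le> 2 / real N + 4 / L ^ 4 + 16384 / L\<^sup>2"
      by linarith
  qed
qed

end

lemma eventually_at_multiples: "eventually (\<lambda>N. N \<in> multiples M) (at_multiples M)"
  by (simp add: at_multiples_def eventually_inf_principal)

lemma tendsto_at_multiples: "(f \<longlongrightarrow> l) sequentially \<Longrightarrow> (f \<longlongrightarrow> l) (at_multiples M)"
  unfolding at_multiples_def by (rule tendsto_mono[OF inf_le1])

theorem theorem1p1:
  fixes M :: nat
    and p :: "nat \<Rightarrow> nat \<Rightarrow> real"   \<comment> \<open>\<open>p N m\<close> is the edge probability inside block \<open>m\<close>\<close>
    and q :: "nat \<Rightarrow> real"
    and b :: "nat \<Rightarrow> nat \<Rightarrow> nat"
    and v :: "nat \<Rightarrow> nat"
    and \<kappa> :: ennreal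
  assumes "1 \<le> M"
    and "\<And>N. N \<in> multiples M \<Longrightarrow> equal_blocks M N (b N)"
    and "\<And>N m. N \<in> multiples M \<Longrightarrow> m \<in> {1..M} \<Longrightarrow> p N m \<in> {0..1}"
    and "\<And>N m m'. N \<in> multiples M \<Longrightarrow> 1 \<le> m \<Longrightarrow> m \<le> m' \<Longrightarrow> m' \<le> M \<Longrightarrow> p N m' \<le> p N m"
    and "\<And>N. N \<in> multiples M \<Longrightarrow> q N \<in> {0..1}"
    and "\<And>m. m \<in> {1..M} \<Longrightarrow>
           ((\<lambda>N. real M * (ln (real N)) ^ 4 / (real N * p N m + real N * (real M - 1) * q N)
                 * ((exp_deg_max M (p N) (q N) N)\<^sup>2 / (exp_deg_min M (p N) (q N) N)\<^sup>2))
            \<longlongrightarrow> 0) (at_multiples M)"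
    and "much_less
           (\<lambda>N. (real M * ln (real N) / real N) powr (1/4)
                * p_min M (p N) powr (5/4) * p_max M (p N) powr (1/2))
           (\<lambda>N. ((real M - 1) * q N)\<^sup>2)
           (at_multiples M)"
    and "((\<lambda>N. ennreal ((real M - 1) * q N) / ennreal (p_min M (p N))) \<longlongrightarrow> \<kappa>) (at_multiples M)"
    and "\<And>N. N \<in> multiples M \<Longrightarrow> v N \<in> verts N"
  shows "aas_asymp (at_multiples M) (\<lambda>N. sbm_pmf N (b N) (p N) (q N))
           (\<lambda>N \<epsilon>. avg_hitting_time N \<epsilon> (v N)) real"
proof -
  let ?F = "at_multiples M"
  let ?L = "\<lambda>N. ln (real N)"
  define \<delta> where "\<delta> N = 2 / real N + 4 / ?L N ^ 4 + 16384 / (?L N)\<^sup>2" for N :: nat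
  define \<eta> where "\<eta> N = 1 - (3 * (1 / real N) + (exp (1 / real N) - 1))" for N :: nat
  have lnN: "filterlim ?L at_top sequentially"
    by (rule filterlim_compose[OF ln_at_top filterlim_real_sequentially])
  have ln_pow: "(\<lambda>N. c / ?L N ^ k) \<longlonglongrightarrow> 0" if "0 < k" for c k
    using that lnN by (intro tendsto_divide_0[OF tendsto_const] filterlim_at_top_imp_at_infinity
        filterlim_pow_at_top) auto
  have "\<delta> \<longlonglongrightarrow> 0 + 0 + 0"
    unfolding \<delta>_def by (intro tendsto_add ln_pow lim_const_over_n) auto
  then have \<delta>: "(\<delta> \<longlongrightarrow> 0) ?F"
    by (intro tendsto_at_multiples) simp
  have "\<eta> \<longlonglongrightarrow> 1 - (3 * 0 + (exp 0 - 1))"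
    unfolding \<eta>_def by (intro tendsto_intros lim_const_over_n)
  then have \<eta>: "(\<eta> \<longlongrightarrow> 1) ?F"
    by (intro tendsto_at_multiples) simp
  have M: "M \<in> {1..M}" using assms(1) by simp
  have "eventually (\<lambda>N. 4 \<le> ?L N) sequentially"
    using lnN by (simp add: filterlim_at_top)
  then have "eventually (\<lambda>N. 4 \<le> ?L N) ?F"
    unfolding at_multiples_def by (rule filter_leD[OF inf_le1])
  moreover note eventually_at_multiples[of M]
  \<comment> \<open>Block \<open>M\<close> has the smallest edge probability, so
    \<open>m = M\<close> is the instance with the smallest denominator.\<close>
  moreover note order_tendstoD(2)[OF assms(6)[OF M] zero_less_one]
  moreover note order_tendstoD(2)[OF conjunct2[OF assms(7)[unfolded much_less_def]] zero_less_one]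
  moreover note conjunct1[OF assms(7)[unfolded much_less_def]]
  ultimately have lower: "\<forall>\<^sub>F N in ?F. \<eta> N \<le> measure_pmf.prob (sbm_pmf N (b N) (p N) (q N))
      {\<epsilon>. \<bar>enn2ereal (avg_hitting_time N \<epsilon> (v N)) / ereal (real N) - 1\<bar> \<le> ereal (\<delta> N)}"
  proof eventually_elim
    case (elim N)
    have Nm: "N \<in> multiples M" by (rule elim)
    interpret sbm M N "b N" "p N" "q N"
      using assms(1-3,5) Nm by unfold_locales (auto simp: multiples_def)
    show ?case
      unfolding \<eta>_def \<delta>_def
      using elim assms(4)[OF Nm] assms(9)[OF Nm] by (intro prob_avg_hitting_time_log) auto
  qed
  have "aas ?F (\<lambda>N. sbm_pmf N (b N) (p N) (q N))
      (\<lambda>N \<epsilon>. \<bar>enn2ereal (avg_hitting_time N \<epsilon> (v N)) / ereal (real N) - 1\<bar> \<le> ereal (\<delta> N))"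
    unfolding aas_def by (rule tendsto_sandwich[OF lower _ \<eta> tendsto_const]) simp
  then show ?thesis
    unfolding aas_asymp_def using \<delta> by blast
qed

end
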